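(* Let $\varepsilon>0$, $N\in\mathbb{N}$, $N\ge1$, and $t=(t_1,\dots,t_N)\in\Delta_N$. Let $\mathbb{X}_1,\dots,\mathbb{X}_N,\mathbb{Y}$ be non-empty and either finite sets or compact subsets of Euclidean spaces. For $i=1,\dots,N$ let $\mu_i\in\mathcal{M}^+(\mathbb{X}_i)$ be fully supported with $\mathrm{KL}(\mu^\otimes,\lambda^\otimes)<\infty$, let $\varphi_i\in\Gamma_0(\mathbb{R})$ be an entropy function, and let $c_i\in C(\mathbb{X}_i\times\mathbb{Y})$ be a non-negative cost function. Put $\mathbb{X}=\mathbb{X}_1\times\dots\times\mathbb{X}_N$ and define $c_t\in C(\mathbb{X}\times\mathbb{Y})$ by $c_t(x_1,\dots,x_N,y)=\sum_{i=1}^N t_ic_i(x_i,y)$. If $\hat\pi$ is optimal for $$\min_{\pi\in\mathcal{M}^+(\mathbb{X}\times\mathbb{Y})}\int_{\mathbb{X}\times\mathbb{Y}}c_t\,\mathrm{d}\pi+\varepsilon E(\pi)+\sum_{i=1}^N D_{t_i\varphi_i}\bigl((P_{\mathbb{X}_i})_\#\pi,\mu_i\bigr),$$ then $(P_{\mathbb{Y}})_\#\hat\pi$ minimizes over $\xi\in\mathcal{M}^+(\mathbb{Y})$ the functional $$F(\xi)=\sum_{i=1}^N t_i\,\mathrm{UOT}_{\varepsilon/t_i}^{(c_i,\varphi_i,\psi)}(\mu_i,\xi)-\varepsilon(N-1)E(\xi),$$ where $\psi=\iota_{\{1\}}$, that is, $$t_i\,\mathrm{UOT}_{\varepsilon/t_i}^{(c_i,\varphi_i,\psi)}(\mu_i,\xi)=\inf\Bigl\{\int_{\mathbb{X}_i\times\mathbb{Y}}t_ic_i\,\mathrm{d}\pi^{(i)}+\varepsilon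 E(\pi^{(i)})+t_iD_{\varphi_i}\bigl((P_{\mathbb{X}_i})_\#\pi^{(i)},\mu_i\bigr):\ \pi^{(i)}\in\mathcal{M}^+(\mathbb{X}_i\times\mathbb{Y}),\ (P_{\mathbb{Y}})_\#\pi^{(i)}=\xi\Bigr\}.$$
   Context: $\mathcal{M}^+(\mathbb{Z})$ denotes the finite non-negative Borel measures on $\mathbb{Z}$. $\Delta_N=\{t\in\mathbb{R}^N:t_i\ge0,\ \sum_i t_i=1\}$. $\mu_i$ is fully supported if $\mathrm{supp}(\mu_i)=\mathbb{X}_i$. $\mu^\otimes=\bigotimes_{i=1}^N\mu_i$. On each of the spaces $\mathbb{X}_i,\mathbb{Y}$ the reference measure is the counting measure $\lambda$ (finite spaces), respectively the Lebesgue measure $\lambda$ (compact subsets of $\mathbb{R}^{d}$); $\lambda^\otimes$ is the corresponding product measure on a product of these spaces. $P_{\mathbb{X}_i},P_{\mathbb{Y}}$ are the coordinate projections and $T_\#\pi=\pi\circ T^{-1}$. $\mathrm{KL}(\mu,\nu)=\int\ln(\tfrac{\mathrm{d}\mu}{\mathrm{d}\nu})\mathrm{d}\mu+\nu(\mathbb{Z})-\mu(\mathbb{Z})$ if $\mu\ll\nu$ (with $0\ln0=0$), $+\infty$ otherwise. The entropy $E$ of a measure is its $\mathrm{KL}$ divergence with respect to the Lebesgue/counting (product) reference measure on its underlying space: $E(\pi)=\mathrm{KL}(\pi,\lambda^\otimes)$, $E(\xi)=\mathrm{KL}(\xi,\lambda)$. $\Gamma_0(\mathbb{R})$: proper, convex,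 lower semi-continuous functions $\mathbb{R}\to(-\infty,+\infty]$. An entropy function is a non-negative $\varphi\in\Gamma_0(\mathbb{R})$ with $\varphi(1)=0$ and $\varphi|_{(-\infty,0)}=\infty$; $\varphi'_\infty=\lim_{x\to\infty}\varphi(x)/x$. For $\mu,\nu\in\mathcal{M}^+(\mathbb{Z})$ with Lebesgue decomposition $\mu=\sigma_\mu\nu+\mu^\perp$, $D_\varphi(\mu,\nu)=\int\varphi\circ\sigma_\mu\,\mathrm{d}\nu+\varphi'_\infty\mu^\perp(\mathbb{Z})$ with $0\cdot\infty=0$; for $t>0$, $D_{t\varphi}=tD_\varphi$. $\iota_{S}$ is $0$ on $S$ and $+\infty$ elsewhere; thus $D_\psi(\mu,\xi)=0$ if $\mu=\xi$ and $+\infty$ otherwise. $\mathrm{UOT}_{\varepsilon/t_i}^{(c_i,\varphi_i,\psi)}(\mu_i,\xi)=\inf_{\pi\in\mathcal{M}^+(\mathbb{X}_i\times\mathbb{Y})}\int c_i\,\mathrm{d}\pi+\tfrac{\varepsilon}{t_i}E(\pi)+D_{\varphi_i}((P_{\mathbb{X}_i})_\#\pi,\mu_i)+D_\psi((P_{\mathbb{Y}})_\#\pi,\xi)$ is entropy-regularized unbalanced optimal transport. $F(\xi)$ is understood as $+\infty$ whenever one of its $\mathrm{UOT}$ terms is $+\infty$. *)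

theory Defs
  imports "HOL-Analysis.Analysis"
begin

section \<open>The underlying spaces\<close>

text \<open>
  A space is a finite set of points of an arbitrary type, or a compact subset of some \<open>\<real>\<^sup>d\<close>.
  As the spaces \<open>X 1, \<dots>, X N\<close> may be of either kind and of different dimensions, \<open>\<real>\<^sup>d\<close> is
  represented by the extensional functions \<open>{..<d} \<rightarrow>\<^sub>E UNIV\<close>, with the topology
  \<open>powertop_real {..<d}\<close> and the Lebesgue measure \<open>\<Pi>\<^sub>M i\<in>{..<d}. lborel\<close>, and both kinds of
  points are injected into one sum type.
\<close>

datatype 'p base_space =
    Finite_Set "'p set"
  | Compact_Set (dimension: nat) "(nat \<Rightarrow> real) set"

type_synonym 'p pt = "'p + (nat \<Rightarrow> real)"

primrec admissible :: "'p base_space \<Rightarrow> bool" where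
  "admissible (Finite_Set A) \<longleftrightarrow> finite A \<and> A \<noteq> {}"
| "admissible (Compact_Set d K) \<longleftrightarrow> compactin (powertop_real {..<d}) K \<and> K \<noteq> {}"

primrec top_of :: "'p base_space \<Rightarrow> 'p pt topology" where
  "top_of (Finite_Set A) = discrete_topology (Inl ` A)"
| "top_of (Compact_Set d K) = pullback_topology (Inr ` K) projr (powertop_real {..<d})"

primrec ref :: "'p base_space \<Rightarrow> 'p pt measure" where
  "ref (Finite_Set A) = count_space (Inl ` A)"
| "ref (Compact_Set d K) = embed_measure (restrict_space (\<Pi>\<^sub>M i\<in>{..<d}. lborel) K) Inr"

text \<open>
  Finite non-negative Borel measures. The Borel sets of an admissible space are the measurable
  sets of its reference measure. All spaces are second countable, so the Borel sets of a product
  are those of the product \<open>\<sigma>\<close>-algebra, i.e. the measurable sets of the product reference measure.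
\<close>

definition M_plus :: "'a measure \<Rightarrow> 'a measure set" where
  "M_plus L = {\<mu>. sets \<mu> = sets L \<and> finite_measure \<mu>}"

definition supp :: "'a topology \<Rightarrow> 'a measure \<Rightarrow> 'a set" where
  "supp T \<mu> = {x \<in> topspace T. \<forall>U. openin T U \<and> x \<in> U \<longrightarrow> emeasure \<mu> U > 0}"

section \<open>Entropy and divergences\<close>

text \<open>Integral of an extended real function whose positive or negative part has finite integral.\<close>

definition ext_integral :: "'a measure \<Rightarrow> ('a \<Rightarrow> ereal) \<Rightarrow> ereal" where
  "ext_integral M f =
     enn2ereal (\<integral>\<^sup>+x. e2ennreal (f x) \<partial>M) - enn2ereal (\<integral>\<^sup>+x. e2ennreal (- f x) \<partial>M)"

text \<open>
  For finite \<open>\<nu>\<close> the negative part of \<open>ln (d\<mu>/d\<nu>)\<close> is always \<open>\<mu>\<close>-integrable; a non-integrable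
  positive part gives the value \<open>\<infinity>\<close>. Note that \<open>absolutely_continuous \<nu> \<mu>\<close> means \<open>\<mu> \<lless> \<nu>\<close>.
\<close>

definition KL :: "'a measure \<Rightarrow> 'a measure \<Rightarrow> ereal" where
  "KL \<mu> \<nu> =
     (if absolutely_continuous \<nu> \<mu>
      then ext_integral \<mu> (\<lambda>x. ereal (ln (enn2real (RN_deriv \<nu> \<mu> x))))
           + ereal (measure \<nu> (space \<nu>)) - ereal (measure \<mu> (space \<mu>))
      else \<infinity>)"

definition Gamma0 :: "(real \<Rightarrow> ereal) set" where
  "Gamma0 = {\<phi>. (\<forall>x. \<phi> x \<noteq> -\<infinity>) \<and> (\<exists>x. \<phi> x \<noteq> \<infinity>)
     \<and> (\<forall>x y u. 0 \<le> u \<and> u \<le> 1 \<longrightarrow>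
           \<phi> (u * x + (1 - u) * y) \<le> ereal u * \<phi> x + ereal (1 - u) * \<phi> y)
     \<and> (\<forall>x. \<phi> x \<le> Liminf (at x) \<phi>)}"

definition entropy_function :: "(real \<Rightarrow> ereal) \<Rightarrow> bool" where
  "entropy_function \<phi> \<longleftrightarrow>
     \<phi> \<in> Gamma0 \<and> (\<forall>x. 0 \<le> \<phi> x) \<and> \<phi> 1 = 0 \<and> (\<forall>x<0. \<phi> x = \<infinity>)"

definition recession :: "(real \<Rightarrow> ereal) \<Rightarrow> ereal" where
  "recession \<phi> = Lim at_top (\<lambda>x. \<phi> x / ereal x)"

definition lebesgue_decomposition ::
  "'a measure \<Rightarrow> 'a measure \<Rightarrow> ('a \<Rightarrow> real) \<Rightarrow> 'a measure \<Rightarrow> bool" where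
  "lebesgue_decomposition \<mu> \<nu> \<sigma> \<mu>s \<longleftrightarrow>
     \<sigma> \<in> borel_measurable \<nu> \<and> (\<forall>x. 0 \<le> \<sigma> x) \<and> sets \<mu>s = sets \<nu>
     \<and> (\<forall>A\<in>sets \<nu>. emeasure \<mu> A = emeasure (density \<nu> (\<lambda>x. ennreal (\<sigma> x))) A + emeasure \<mu>s A)
     \<and> (\<exists>S\<in>sets \<nu>. emeasure \<nu> S = 0 \<and> emeasure \<mu>s (space \<nu> - S) = 0)"

text \<open>
  For finite measures the decomposition exists and is unique up to \<open>\<nu>\<close>-null sets, so the value
  does not depend on the choice. The product on \<^typ>\<open>ereal\<close> satisfies \<open>0 * \<infinity> = 0\<close>.
\<close>

definition D :: "(real \<Rightarrow> ereal) \<Rightarrow> 'a measure \<Rightarrow> 'a measure \<Rightarrow> ereal" where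
  "D \<phi> \<mu> \<nu> =
     (case SOME (\<sigma>, \<mu>s). lebesgue_decomposition \<mu> \<nu> \<sigma> \<mu>s of
        (\<sigma>, \<mu>s) \<Rightarrow> enn2ereal (\<integral>\<^sup>+x. e2ennreal (\<phi> (\<sigma> x)) \<partial>\<nu>)
                    + recession \<phi> * enn2ereal (emeasure \<mu>s (space \<mu>s)))"

definition iota :: "real set \<Rightarrow> real \<Rightarrow> ereal" where
  "iota S x = (if x \<in> S then 0 else \<infinity>)"

section \<open>Unbalanced optimal transport\<close>

text \<open>\<open>LX\<close> and \<open>LY\<close> are the reference measures of the two spaces.\<close>

definition UOT ::
  "'a measure \<Rightarrow> 'b measure \<Rightarrow> real \<Rightarrow> ('a \<times> 'b \<Rightarrow> real) \<Rightarrow> (real \<Rightarrow> ereal) \<Rightarrow> (real \<Rightarrow> ereal)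
    \<Rightarrow> 'a measure \<Rightarrow> 'b measure \<Rightarrow> ereal" where
  "UOT LX LY \<epsilon> c \<phi> \<psi> \<mu> \<xi> =
     (INF \<pi> \<in> M_plus (LX \<Otimes>\<^sub>M LY).
        ereal (\<integral>z. c z \<partial>\<pi>) + ereal \<epsilon> * KL \<pi> (LX \<Otimes>\<^sub>M LY)
        + D \<phi> (distr \<pi> LX fst) \<mu> + D \<psi> (distr \<pi> LY snd) \<xi>)"

text \<open>
  The term \<open>t * UOT\<^bsub>\<epsilon>/t\<^esub>\<close> with \<open>\<psi> = \<iota>\<^bsub>{1}\<^esub>\<close>. For \<open>t = 0\<close>, where \<open>\<epsilon>/t\<close> is undefined, it stands
  for the infimum obtained by multiplying out the factor \<open>t\<close> (and \<open>D \<psi> (P\<^sub>Y \<pi>) \<xi>\<close> being the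
  constraint \<open>P\<^sub>Y \<pi> = \<xi>\<close>).
\<close>

definition weighted_UOT ::
  "'a measure \<Rightarrow> 'b measure \<Rightarrow> real \<Rightarrow> real \<Rightarrow> ('a \<times> 'b \<Rightarrow> real) \<Rightarrow> (real \<Rightarrow> ereal)
    \<Rightarrow> 'a measure \<Rightarrow> 'b measure \<Rightarrow> ereal" where
  "weighted_UOT LX LY \<epsilon> t c \<phi> \<mu> \<xi> =
     (if t \<noteq> 0 then ereal t * UOT LX LY (\<epsilon> / t) c \<phi> (iota {1}) \<mu> \<xi>
      else (INF \<pi> \<in> {\<pi> \<in> M_plus (LX \<Otimes>\<^sub>M LY). distr \<pi> LY snd = \<xi>}.
              ereal (\<integral>z. t * c z \<partial>\<pi>) + ereal \<epsilon> * KL \<pi> (LX \<Otimes>\<^sub>M LY)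
              + ereal t * D \<phi> (distr \<pi> LX fst) \<mu>))"

text \<open>
  Multi-marginal problem on \<open>(X 1 \<times> \<dots> \<times> X N) \<times> Y\<close>; the points of the first factor are the
  extensional functions on \<open>{1..N}\<close>.
\<close>

definition ref_X :: "nat \<Rightarrow> (nat \<Rightarrow> 'p base_space) \<Rightarrow> (nat \<Rightarrow> 'p pt) measure" where
  "ref_X N X = (\<Pi>\<^sub>M i\<in>{1..N}. ref (X i))"

definition c_t :: "nat \<Rightarrow> (nat \<Rightarrow> real) \<Rightarrow> (nat \<Rightarrow> 'a \<times> 'b \<Rightarrow> real) \<Rightarrow> (nat \<Rightarrow> 'a) \<times> 'b \<Rightarrow> real" where
  "c_t N t c = (\<lambda>(x, y). \<Sum>i=1..N. t i * c i (x i, y))"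

definition multi_marginal_objective ::
  "nat \<Rightarrow> real \<Rightarrow> (nat \<Rightarrow> real) \<Rightarrow> (nat \<Rightarrow> 'p base_space) \<Rightarrow> 'q base_space
    \<Rightarrow> (nat \<Rightarrow> 'p pt \<times> 'q pt \<Rightarrow> real) \<Rightarrow> (nat \<Rightarrow> real \<Rightarrow> ereal) \<Rightarrow> (nat \<Rightarrow> 'p pt measure)
    \<Rightarrow> ((nat \<Rightarrow> 'p pt) \<times> 'q pt) measure \<Rightarrow> ereal" where
  "multi_marginal_objective N \<epsilon> t X Y c \<phi> \<mu> \<pi> =
     ereal (\<integral>z. c_t N t c z \<partial>\<pi>) + ereal \<epsilon> * KL \<pi> (ref_X N X \<Otimes>\<^sub>M ref Y)
     + (\<Sum>i=1..N. D (\<lambda>s. ereal (t i) * \<phi> i s) (distr \<pi> (ref (X i)) (\<lambda>(x, y). x i)) (\<mu> i))"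

definition barycenter_objective ::
  "nat \<Rightarrow> real \<Rightarrow> (nat \<Rightarrow> real) \<Rightarrow> (nat \<Rightarrow> 'p base_space) \<Rightarrow> 'q base_space
    \<Rightarrow> (nat \<Rightarrow> 'p pt \<times> 'q pt \<Rightarrow> real) \<Rightarrow> (nat \<Rightarrow> real \<Rightarrow> ereal) \<Rightarrow> (nat \<Rightarrow> 'p pt measure)
    \<Rightarrow> 'q pt measure \<Rightarrow> ereal" where
  "barycenter_objective N \<epsilon> t X Y c \<phi> \<mu> \<xi> =
     (let U = (\<lambda>i. weighted_UOT (ref (X i)) (ref Y) \<epsilon> (t i) (c i) (\<phi> i) (\<mu> i) \<xi>)
      in if \<exists>i\<in>{1..N}. U i = \<infinity> then \<infinity>
         else (\<Sum>i=1..N. U i) - ereal (\<epsilon> * (real N - 1)) * KL \<xi> (ref Y))"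

definition minimizes_over :: "('a \<Rightarrow> ereal) \<Rightarrow> 'a set \<Rightarrow> 'a \<Rightarrow> bool" where
  "minimizes_over J S a \<longleftrightarrow> a \<in> S \<and> (\<forall>b\<in>S. J a \<le> J b)"

end

theory Submission
  imports Defs
begin

text \<open>
  The proof rests on the chain rule for the entropy. Let \<open>\<pi>\<close> be a plan on
  \<open>(X\<^sub>1 \<times> \<dots> \<times> X\<^sub>N) \<times> Y\<close> with marginals \<open>\<pi>\<^sub>i\<close> on \<open>X\<^sub>i \<times> Y\<close> and \<open>\<xi>\<close> on \<open>Y\<close>. Then
  \<open>E(\<pi>) \<ge> \<Sum>\<^sub>i E(\<pi>\<^sub>i) - (N - 1) E(\<xi>) + C\<close> with a constant \<open>C\<close> that depends only on the masses of the
  reference measures, and equality holds if the coordinates \<open>x\<^sub>1, \<dots>, x\<^sub>N\<close> are conditionally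
  independent given \<open>y\<close>. Cost and divergence terms of the multi-marginal objective \<open>J\<close> depend on
  the plan only through the \<open>\<pi>\<^sub>i\<close>.

  Hence \<open>F(\<xi>) + \<epsilon> C \<le> J(\<pi>)\<close> for every plan \<open>\<pi>\<close> of finite value with \<open>Y\<close>-marginal \<open>\<xi>\<close>, because the
  \<open>\<pi>\<^sub>i\<close> are admissible in the transport problems that define \<open>F(\<xi>)\<close>
  (\<open>objective_ge_barycenter_functional\<close>). Conversely, nearly optimal plans \<open>\<pi>\<^sub>i\<close> for these problems
  share the marginal \<open>\<xi>\<close>, and gluing them along \<open>Y\<close> with conditional independence gives a plan of
  value at most \<open>F(\<xi>) + \<epsilon> C\<close> up to an arbitrarily small error. Therefore \<open>min J \<le> F(\<xi>) + \<epsilon> C\<close>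
  whenever \<open>F(\<xi>)\<close> is finite (\<open>objective_minimum_le_barycenter_functional\<close>), and for an optimal plan
  with marginal \<open>\<xi>\<^sub>0\<close> one gets \<open>F(\<xi>\<^sub>0) + \<epsilon> C \<le> min J \<le> F(\<xi>) + \<epsilon> C\<close>.

  The chain rule is proved with densities (\<open>KL_ge_sum_pair_marginals\<close>, \<open>KL_of_glued_plan\<close>): if
  \<open>p\<^sub>i\<close> and \<open>q\<close> are the densities of \<open>\<pi>\<^sub>i\<close> and \<open>\<xi>\<close>, the glued plan has the density
  \<open>\<Prod>\<^sub>i p\<^sub>i(x\<^sub>i, y) / q(y)\<^sup>N\<^sup>-\<^sup>1\<close>, and the inequality is Gibbs' inequality against this density. As
  entropies may be infinite and enter with both signs, it has to be known beforehand that finite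
  entropy of a plan makes the logarithms of all its marginal densities integrable
  (\<open>KL_finite_distr\<close>).
\<close>

section \<open>Entropy in terms of densities\<close>

lemma mult_neg_ln_le:
  fixes a :: real
  assumes "0 \<le> a"
  shows "a * - ln a \<le> 1 - a"
proof (cases "a = 0")
  case False
  then have pos: "0 < a" using assms by simp
  have "- ln a = ln (1 / a)" using pos by (simp add: ln_div)
  also have "\<dots> \<le> 1 / a - 1" using pos by (intro ln_le_minus_one) simp
  finally have "a * - ln a \<le> a * (1 / a - 1)" using assms by (rule mult_left_mono)
  also have "\<dots> = 1 - a" using pos by (simp add: field_simps)
  finally show ?thesis .
qed simp

text \<open>
  Since \<open>- f ln f \<le> 1\<close>, the negative part of \<open>ln f\<close> costs at most \<open>\<nu>(space \<nu>)\<close> when it is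
  integrated against \<open>f \<nu>\<close>. So the divergence of a finite measure with density \<open>f\<close> can only be infinite
  through the positive part of \<open>ln f\<close>.
\<close>

lemma neg_ln_density_finite:
  fixes f :: "'a \<Rightarrow> real"
  assumes "finite_measure \<nu>" and [measurable]: "f \<in> borel_measurable \<nu>" and nn: "\<And>x. 0 \<le> f x"
  shows "(\<integral>\<^sup>+x. ennreal (- ln (f x)) \<partial>density \<nu> (\<lambda>x. ennreal (f x))) < \<infinity>"
proof -
  interpret finite_measure \<nu> by fact
  have "f x * - ln (f x) \<le> 1" for x
    using mult_neg_ln_le[OF nn[of x]] nn[of x] by linarith
  then have "ennreal (f x) * ennreal (- ln (f x)) \<le> 1" for x
    by (subst ennreal_mult'[symmetric])
       (auto simp: nn ennreal_le_1 simp del: mult_minus_right)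
  then have "(\<integral>\<^sup>+x. ennreal (- ln (f x)) \<partial>density \<nu> (\<lambda>x. ennreal (f x))) \<le> (\<integral>\<^sup>+x. 1 \<partial>\<nu>)"
    by (subst nn_integral_density) (auto intro!: nn_integral_mono simp del: nn_integral_const)
  also have "\<dots> < \<infinity>" by (simp add: less_top[symmetric])
  finally show ?thesis .
qed

lemma integrable_from_parts:
  fixes g :: "'a \<Rightarrow> real"
  assumes [measurable]: "g \<in> borel_measurable \<mu>"
    and "(\<integral>\<^sup>+x. ennreal (g x) \<partial>\<mu>) < \<infinity>" and "(\<integral>\<^sup>+x. ennreal (- g x) \<partial>\<mu>) < \<infinity>"
  shows "integrable \<mu> g"
  using assms by (simp add: real_integrable_def less_top[symmetric] )

lemma ext_integral_integrable:
  assumes g: "integrable \<mu> g"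
  shows "ext_integral \<mu> (\<lambda>x. ereal (g x)) = ereal (\<integral>x. g x \<partial>\<mu>)"
proof -
  have fin: "(\<integral>\<^sup>+x. ennreal (g x) \<partial>\<mu>) \<noteq> \<infinity>" "(\<integral>\<^sup>+x. ennreal (- g x) \<partial>\<mu>) \<noteq> \<infinity>"
    using g by (auto simp: real_integrable_def)
  have "enn2ereal r = ereal (enn2real r)" if "r \<noteq> \<infinity>" for r
    using that by (cases r) (auto simp: enn2ereal_ennreal)
  then show ?thesis
    using fin by (simp add: ext_integral_def real_lebesgue_integral_def[OF g])
qed

lemma density_real_RN_deriv:
  assumes "finite_measure \<nu>" "finite_measure \<mu>" "sets \<mu> = sets \<nu>" "absolutely_continuous \<nu> \<mu>"
  shows "\<mu> = density \<nu> (\<lambda>x. ennreal (enn2real (RN_deriv \<nu> \<mu> x)))"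
proof -
  interpret n: finite_measure \<nu> by fact
  interpret m: finite_measure \<mu> by fact
  have "AE x in \<nu>. RN_deriv \<nu> \<mu> x \<noteq> \<infinity>"
    by (rule n.RN_deriv_finite) (use assms in \<open>auto intro: m.sigma_finite_measure_axioms\<close>)
  then have "density \<nu> (\<lambda>x. ennreal (enn2real (RN_deriv \<nu> \<mu> x))) = density \<nu> (RN_deriv \<nu> \<mu>)"
    by (intro density_cong) (auto simp: less_top)
  then show ?thesis using n.density_RN_deriv assms by simp
qed

text \<open>
  Together with \<open>KL_finite_density\<close> this replaces the extended integral in the definition of the
  divergence: a finite divergence is the same as a real density with \<open>\<mu>\<close>-integrable logarithm, and
  its value is then a Bochner integral, to which linearity applies.
\<close>

lemma KL_density:
  fixes f :: "'a \<Rightarrow> real"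
  assumes "finite_measure \<nu>" and f[measurable]: "f \<in> borel_measurable \<nu>" and nn: "\<And>x. 0 \<le> f x"
    and \<mu>: "\<mu> = density \<nu> (\<lambda>x. ennreal (f x))" "finite_measure \<mu>"
    and int: "integrable \<mu> (\<lambda>x. ln (f x))"
  shows "KL \<mu> \<nu> = ereal ((\<integral>x. ln (f x) \<partial>\<mu>) + measure \<nu> (space \<nu>) - measure \<mu> (space \<mu>))"
proof -
  interpret n: finite_measure \<nu> by fact
  have ac: "absolutely_continuous \<nu> \<mu>" unfolding \<mu> by (rule absolutely_continuousI_density) measurable
  have "AE x in \<nu>. ennreal (f x) = RN_deriv \<nu> \<mu> x"
    by (rule n.RN_deriv_unique) (auto simp: \<mu>)
  then have AE: "AE x in \<mu>. f x = enn2real (RN_deriv \<nu> \<mu> x)"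
    unfolding \<mu>(1) by (subst AE_density) (auto elim!: eventually_mono simp: nn dest: arg_cong[of _ _ enn2real])
  have sets: "sets \<mu> = sets \<nu>" by (simp add: \<mu>)
  note [measurable_cong] = sets
  have mu_meas: "(\<lambda>x. ln (enn2real (RN_deriv \<nu> \<mu> x))) \<in> borel_measurable \<mu>" by measurable
  have i2: "integrable \<mu> (\<lambda>x. ln (enn2real (RN_deriv \<nu> \<mu> x)))"
    using int by (rule integrable_cong_AE_imp) (use mu_meas AE in auto)
  have "(\<integral>x. ln (enn2real (RN_deriv \<nu> \<mu> x)) \<partial>\<mu>) = (\<integral>x. ln (f x) \<partial>\<mu>)"
    by (rule integral_cong_AE) (use mu_meas AE in auto)
  then show ?thesis using ac by (simp add: KL_def ext_integral_integrable[OF i2])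
qed

lemma KL_finite_density:
  assumes "finite_measure \<nu>" and \<mu>: "\<mu> \<in> M_plus \<nu>" and fin: "KL \<mu> \<nu> \<noteq> \<infinity>"
  obtains f :: "'a \<Rightarrow> real" where "f \<in> borel_measurable \<nu>" "\<And>x. 0 \<le> f x"
    "\<mu> = density \<nu> (\<lambda>x. ennreal (f x))" "integrable \<mu> (\<lambda>x. ln (f x))"
proof -
  interpret n: finite_measure \<nu> by fact
  interpret m: finite_measure \<mu> using \<mu> by (simp add: M_plus_def)
  have sets[measurable_cong]: "sets \<mu> = sets \<nu>" using \<mu> by (simp add: M_plus_def)
  have ac: "absolutely_continuous \<nu> \<mu>" using fin by (auto simp: KL_def split: if_splits)
  define f where "f = (\<lambda>x. enn2real (RN_deriv \<nu> \<mu> x))"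
  have f: "f \<in> borel_measurable \<nu>" "\<And>x. 0 \<le> f x" unfolding f_def by auto
  note [measurable] = f(1)
  have d: "\<mu> = density \<nu> (\<lambda>x. ennreal (f x))"
    unfolding f_def by (rule density_real_RN_deriv) (use sets ac n.finite_measure_axioms m.finite_measure_axioms in auto)
  have neg: "(\<integral>\<^sup>+x. ennreal (- ln (f x)) \<partial>\<mu>) < \<infinity>"
    using neg_ln_density_finite[OF assms(1) f] d by simp
  then obtain r where r: "(\<integral>\<^sup>+x. ennreal (- ln (f x)) \<partial>\<mu>) = ennreal r" "0 \<le> r"
    by (cases "(\<integral>\<^sup>+x. ennreal (- ln (f x)) \<partial>\<mu>)") auto
  have "(\<integral>\<^sup>+x. ennreal (ln (f x)) \<partial>\<mu>) < \<infinity>"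
  proof (rule ccontr)
    assume "\<not> ?thesis"
    then have "(\<integral>\<^sup>+x. ennreal (ln (f x)) \<partial>\<mu>) = top" by (simp add: less_top[symmetric])
    with fin ac show False
      by (simp add: KL_def f_def[symmetric] ext_integral_def r enn2ereal_ennreal fun_cong[OF f_def, symmetric])
  qed
  then have "integrable \<mu> (\<lambda>x. ln (f x))"
    by (intro integrable_from_parts neg) (auto simp: sets)
  with f d show ?thesis by (rule that)
qed

text \<open>
  The sum of the integral and of the two masses is the integral of \<open>f ln f + 1 - f \<ge> 0\<close>.
\<close>

lemma KL_nonneg:
  assumes "finite_measure \<nu>" and \<mu>: "\<mu> \<in> M_plus \<nu>"
  shows "0 \<le> KL \<mu> \<nu>"
proof (cases "KL \<mu> \<nu> = \<infinity>")
  case False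
  interpret n: finite_measure \<nu> by fact
  interpret m: finite_measure \<mu> using \<mu> by (simp add: M_plus_def)
  obtain f where f[measurable]: "f \<in> borel_measurable \<nu>" and nn: "\<And>x. 0 \<le> f x"
    and d: "\<mu> = density \<nu> (\<lambda>x. ennreal (f x))" and i: "integrable \<mu> (\<lambda>x. ln (f x))"
    using KL_finite_density[OF assms False] by blast
  have if1: "integrable \<nu> (\<lambda>x. f x * ln (f x))" 
    using i unfolding d by (subst (asm) integrable_density) (auto simp: nn)
  have if2: "integrable \<nu> f"
  proof -
    have "integrable \<mu> (\<lambda>x. 1::real)" by simp
    then show ?thesis unfolding d by (subst (asm) integrable_density) (auto simp: nn)
  qed
  have "(\<integral>x. ln (f x) \<partial>\<mu>) = (\<integral>x. f x * ln (f x) \<partial>\<nu>)"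
    unfolding d by (subst integral_density) (auto simp: nn)
  moreover have "measure \<mu> (space \<mu>) = (\<integral>x. f x \<partial>\<nu>)"
  proof -
    have "measure \<mu> (space \<mu>) = (\<integral>x. 1 \<partial>\<mu>)" by simp
    also have "\<dots> = (\<integral>x. f x \<partial>\<nu>)" unfolding d by (subst integral_density) (auto simp: nn)
    finally show ?thesis .
  qed
  moreover have "measure \<nu> (space \<nu>) = (\<integral>x. 1 \<partial>\<nu>)" by simp
  moreover have "0 \<le> (\<integral>x. f x * ln (f x) + 1 - f x \<partial>\<nu>)"
  proof (rule Bochner_Integration.integral_nonneg)
    fix x
    show "0 \<le> f x * ln (f x) + 1 - f x"
      using mult_neg_ln_le[OF nn[of x]] by simp
  qed
  ultimately have "0 \<le> (\<integral>x. ln (f x) \<partial>\<mu>) + measure \<nu> (space \<nu>) - measure \<mu> (space \<mu>)"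
    using if1 if2 by (simp del: lebesgue_integral_const)
  then show ?thesis
    using KL_density[OF assms(1) f nn d m.finite_measure_axioms i] by simp
qed simp

text \<open>
  Young's inequality \<open>p ln g \<le> p ln p + g\<close>: finite entropy of \<open>p M\<close> controls the positive part of
  the logarithm of every nonnegative \<open>M\<close>-integrable function. With \<open>g\<close> a marginal density, this
  makes all logarithms in the chain rule integrable, so that they may be added and
  subtracted freely.
\<close>

lemma nn_integral_pos_ln_finite:
  fixes p g :: "'a \<Rightarrow> real"
  assumes "finite_measure M" and p[measurable]: "p \<in> borel_measurable M" and pnn: "\<And>z. 0 \<le> p z"
    and \<pi>: "\<pi> = density M (\<lambda>z. ennreal (p z))" "finite_measure \<pi>" "integrable \<pi> (\<lambda>z. ln (p z))"
    and g[measurable]: "g \<in> borel_measurable M" and gnn: "\<And>z. 0 \<le> g z" and gi: "(\<integral>\<^sup>+z. ennreal (g z) \<partial>M) < \<infinity>"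
  shows "(\<integral>\<^sup>+z. ennreal (ln (g z)) \<partial>\<pi>) < \<infinity>"
proof -
  interpret finite_measure M by fact
  interpret m: finite_measure \<pi> by fact
  have i1: "integrable M (\<lambda>z. p z * ln (p z))"
    using \<pi>(3) unfolding \<pi>(1) by (subst (asm) integrable_density) (auto simp: pnn)
  have i2: "integrable M g" using gi by (intro integrableI_nonneg) (auto simp: gnn)
  have bound: "p z * ln (g z) \<le> \<bar>p z * ln (p z)\<bar> + g z" for z
  proof (cases "p z = 0 \<or> g z = 0")
    case True
    then show ?thesis using gnn[of z] by (auto simp: add_nonneg_nonneg)
  next
    case False
    then have pos: "p z > 0" "g z > 0" using pnn[of z] gnn[of z] by (auto simp: less_le)
    have "ln (g z) - ln (p z) \<le> g z / p z - 1"
      using pos ln_le_minus_one[of "g z / p z"] by (simp add: ln_div)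
    then have "p z * (ln (g z) - ln (p z)) \<le> p z * (g z / p z - 1)" using pos by (intro mult_left_mono) auto
    also have "\<dots> = g z - p z" using pos by (simp add: field_simps)
    finally show ?thesis using pos by (simp add: algebra_simps)
  qed
  have "(\<integral>\<^sup>+z. ennreal (ln (g z)) \<partial>\<pi>) = (\<integral>\<^sup>+z. ennreal (p z) * ennreal (ln (g z)) \<partial>M)"
    unfolding \<pi>(1) by (subst nn_integral_density) auto
  also have "\<dots> \<le> (\<integral>\<^sup>+z. ennreal (\<bar>p z * ln (p z)\<bar> + g z) \<partial>M)"
    by (intro nn_integral_mono) (simp add: ennreal_mult'[symmetric] pnn bound ennreal_leI)
  also have "\<dots> < \<infinity>"
    using i1 i2 by (subst nn_integral_eq_integral) (auto simp: gnn)
  finally show ?thesis .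
qed

text \<open>
  The qualitative part of the data processing inequality: finite entropy passes to the image under
  a map \<open>T\<close> that sends the reference measure to a multiple of the new one. Coordinate projections
  of finite product measures are such maps, the factor being the mass of what is projected away.
\<close>

lemma KL_finite_distr:
  assumes M: "finite_measure M" "finite_measure M'" and T[measurable]: "T \<in> measurable M M'"
    and K: "distr M M' T = scale_measure K M'" "K < \<infinity>"
    and \<pi>: "\<pi> \<in> M_plus M" "KL \<pi> M \<noteq> \<infinity>"
  obtains g :: "'b \<Rightarrow> real" where "g \<in> borel_measurable M'" "\<And>x. 0 \<le> g x"
    "distr \<pi> M' T = density M' (\<lambda>x. ennreal (g x))" "integrable (distr \<pi> M' T) (\<lambda>x. ln (g x))"
proof -
  interpret finite_measure M by fact
  interpret m: finite_measure \<pi> using \<pi> by (simp add: M_plus_def)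
  interpret M': finite_measure M' by fact
  have sets[measurable_cong]: "sets \<pi> = sets M" using \<pi> by (simp add: M_plus_def)
  obtain p where p[measurable]: "p \<in> borel_measurable M" and pnn: "\<And>x. 0 \<le> p x"
    and d: "\<pi> = density M (\<lambda>x. ennreal (p x))" and i: "integrable \<pi> (\<lambda>x. ln (p x))"
    using KL_finite_density[OF M(1) \<pi>] by blast
  let ?\<pi> = "distr \<pi> M' T"
  have fin': "finite_measure ?\<pi>" by (rule m.finite_measure_distr) measurable
  interpret p': finite_measure ?\<pi> by fact
  have ac: "absolutely_continuous M' ?\<pi>"
    unfolding absolutely_continuous_def
  proof
    fix A assume A: "A \<in> null_sets M'"
    then have [measurable]: "A \<in> sets M'" by auto
    have "emeasure M (T -` A \<inter> space M) = emeasure (distr M M' T) A" by (simp add: emeasure_distr)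
    also have "\<dots> = 0" using A unfolding K by (simp add: null_setsD1)
    finally have "T -` A \<inter> space M \<in> null_sets M" by auto
    moreover have "absolutely_continuous M \<pi>" unfolding d by (rule absolutely_continuousI_density) measurable
    ultimately have "T -` A \<inter> space M \<in> null_sets \<pi>" by (auto simp: absolutely_continuous_def)
    moreover have "space \<pi> = space M" using sets by (rule sets_eq_imp_space_eq)
    ultimately show "A \<in> null_sets ?\<pi>" by (auto simp: null_sets_def emeasure_distr)
  qed
  define g where "g = (\<lambda>x. enn2real (RN_deriv M' ?\<pi> x))"
  have g[measurable]: "g \<in> borel_measurable M'" and gnn: "\<And>x. 0 \<le> g x" unfolding g_def by auto
  have gd: "?\<pi> = density M' (\<lambda>x. ennreal (g x))"
    unfolding g_def by (rule density_real_RN_deriv) (use M fin' ac in auto)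
  \<comment> \<open>\<open>g \<circ> T\<close> is \<open>M\<close>-integrable, so Young's inequality bounds the positive part of \<open>ln (g \<circ> T)\<close>.\<close>
  have "(\<integral>\<^sup>+z. ennreal (g (T z)) \<partial>M) = (\<integral>\<^sup>+x. ennreal (g x) \<partial>distr M M' T)"
    by (simp add: nn_integral_distr)
  also have "\<dots> = K * (\<integral>\<^sup>+x. ennreal (g x) \<partial>M')" unfolding K by (simp add: nn_integral_scale_measure)
  also have "(\<integral>\<^sup>+x. ennreal (g x) \<partial>M') = emeasure ?\<pi> (space M')"
    unfolding gd by (subst emeasure_density) (auto intro!: nn_integral_cong)
  also have "K * \<dots> < \<infinity>" using K(2) p'.emeasure_finite[of "space M'"] by (auto simp: ennreal_mult_eq_top_iff less_top[symmetric])
  finally have "(\<integral>\<^sup>+z. ennreal (ln (g (T z))) \<partial>\<pi>) < \<infinity>"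
    by (intro nn_integral_pos_ln_finite[OF M(1) p pnn d _ i]) (auto simp: gnn m.finite_measure_axioms)
  then have "(\<integral>\<^sup>+x. ennreal (ln (g x)) \<partial>?\<pi>) < \<infinity>" by (simp add: nn_integral_distr)
  moreover have "(\<integral>\<^sup>+x. ennreal (- ln (g x)) \<partial>?\<pi>) < \<infinity>"
    using neg_ln_density_finite[OF M(2) g gnn] gd by simp
  ultimately have "integrable ?\<pi> (\<lambda>x. ln (g x))" by (intro integrable_from_parts) auto
  with g gnn gd show ?thesis by (rule that)
qed

section \<open>The chain rule for the entropy\<close>

lemma AE_density_pos:
  fixes f :: "'a \<Rightarrow> real"
  assumes [measurable]: "f \<in> borel_measurable \<nu>" and "\<And>x. 0 \<le> f x"
  shows "AE x in density \<nu> (\<lambda>x. ennreal (f x)). 0 < f x"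
  by (subst AE_density) auto

text \<open>
  The density of the second marginal is the fibre integral of the joint density; densities
  are unique up to null sets.
\<close>

lemma AE_fibre_integral_eq:
  fixes p :: "'a \<times> 'b \<Rightarrow> real" and q :: "'b \<Rightarrow> real"
  assumes "sigma_finite_measure L" "sigma_finite_measure LY"
    and p[measurable]: "p \<in> borel_measurable (L \<Otimes>\<^sub>M LY)"
    and q[measurable]: "q \<in> borel_measurable LY"
    and eq: "distr (density (L \<Otimes>\<^sub>M LY) (\<lambda>z. ennreal (p z))) LY snd = density LY (\<lambda>y. ennreal (q y))"
  shows "AE y in LY. (\<integral>\<^sup>+x. ennreal (p (x, y)) \<partial>L) = ennreal (q y)"
proof -
  interpret L: sigma_finite_measure L by fact
  interpret Y: sigma_finite_measure LY by fact
  interpret pair_sigma_finite L LY ..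
  have "density LY (\<lambda>y. \<integral>\<^sup>+x. ennreal (p (x, y)) \<partial>L)
      = distr (density (L \<Otimes>\<^sub>M LY) (\<lambda>z. ennreal (p z))) LY snd"
  proof (rule measure_eqI)
    fix A assume "A \<in> sets (density LY (\<lambda>y. \<integral>\<^sup>+x. ennreal (p (x, y)) \<partial>L))"
    then have [measurable]: "A \<in> sets LY" by simp
    have "emeasure (distr (density (L \<Otimes>\<^sub>M LY) (\<lambda>z. ennreal (p z))) LY snd) A
        = (\<integral>\<^sup>+z. ennreal (p z) * indicator (snd -` A \<inter> space (L \<Otimes>\<^sub>M LY)) z \<partial>(L \<Otimes>\<^sub>M LY))"
      by (subst emeasure_distr) (auto simp: emeasure_density)
    also have "\<dots> = (\<integral>\<^sup>+z. ennreal (p z) * indicator A (snd z) \<partial>(L \<Otimes>\<^sub>M LY))"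
      by (intro nn_integral_cong) (auto simp: indicator_def)
    also have "\<dots> = (\<integral>\<^sup>+y. \<integral>\<^sup>+x. ennreal (p (x, y)) * indicator A y \<partial>L \<partial>LY)"
      by (subst nn_integral_snd[symmetric]) (auto simp: case_prod_beta)
    also have "\<dots> = (\<integral>\<^sup>+y. (\<integral>\<^sup>+x. ennreal (p (x, y)) \<partial>L) * indicator A y \<partial>LY)"
      by (intro nn_integral_cong nn_integral_multc) measurable
    finally show "emeasure (density LY (\<lambda>y. \<integral>\<^sup>+x. ennreal (p (x, y)) \<partial>L)) A
        = emeasure (distr (density (L \<Otimes>\<^sub>M LY) (\<lambda>z. ennreal (p z))) LY snd) A"
      by (simp add: emeasure_density)
  qed simp
  then show ?thesis using eq by (intro Y.density_unique) auto
qed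

lemma distr_snd_pair:
  assumes "finite_measure L" "finite_measure LY"
  shows "distr (L \<Otimes>\<^sub>M LY) LY snd = scale_measure (emeasure L (space L)) LY"
proof (rule measure_eqI)
  interpret L: finite_measure L by fact
  interpret Y: finite_measure LY by fact
  interpret pair_sigma_finite L LY ..
  fix A assume "A \<in> sets (distr (L \<Otimes>\<^sub>M LY) LY snd)"
  then have [measurable]: "A \<in> sets LY" by simp
  have "snd -` A \<inter> space (L \<Otimes>\<^sub>M LY) = space L \<times> A"
    using sets.sets_into_space[OF \<open>A \<in> sets LY\<close>] by (auto simp: space_pair_measure)
  then show "emeasure (distr (L \<Otimes>\<^sub>M LY) LY snd) A = emeasure (scale_measure (emeasure L (space L)) LY) A"
    by (simp add: emeasure_distr Y.emeasure_pair_measure_Times)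
qed simp

locale finite_product_spaces =
  fixes I :: "'i set" and L :: "'i \<Rightarrow> 'a measure" and LY :: "'b measure"
  assumes finite_I: "finite I" and nonempty_I: "I \<noteq> {}"
    and finite_L: "\<And>i. finite_measure (L i)" and finite_LY: "finite_measure LY"
begin

abbreviation M :: "(('i \<Rightarrow> 'a) \<times> 'b) measure" where "M \<equiv> PiM I L \<Otimes>\<^sub>M LY"

abbreviation T :: "'i \<Rightarrow> ('i \<Rightarrow> 'a) \<times> 'b \<Rightarrow> 'a \<times> 'b" where
  "T i \<equiv> \<lambda>z. (fst z i, snd z)"

sublocale Y: finite_measure LY by (rule finite_LY)
sublocale Li: finite_measure "L i" for i by (rule finite_L)
sublocale product_sigma_finite L ..
sublocale pair_i: pair_sigma_finite "L i" LY for i ..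

lemma finite_PiM: "finite_measure (PiM I L)"
proof (rule finite_measureI)
  have "emeasure (PiM I L) (space (PiM I L)) = (\<Prod>i\<in>I. emeasure (L i) (space (L i)))"
    unfolding space_PiM by (intro emeasure_PiM finite_I) auto
  then show "emeasure (PiM I L) (space (PiM I L)) \<noteq> \<infinity>"
    using finite_I by (simp add: ennreal_prod_eq_top)
qed

sublocale P: finite_measure "PiM I L" by (rule finite_PiM)
sublocale pair_P: pair_sigma_finite "PiM I L" LY ..

lemma finite_M: "finite_measure M"
  by (intro finite_measure_pair_measure finite_PiM finite_LY)

lemma finite_Mi: "finite_measure (L i \<Otimes>\<^sub>M LY)"
  by (intro finite_measure_pair_measure finite_L finite_LY)

lemma T_measurable[measurable]: "i \<in> I \<Longrightarrow> T i \<in> M \<rightarrow>\<^sub>M L i \<Otimes>\<^sub>M LY"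
  by measurable

text \<open>
  For fixed \<open>y\<close> the coordinates \<open>x\<^sub>i\<close> separate, so Tonelli turns the integral of a product of functions
  of the pairs \<open>(x\<^sub>i, y)\<close> into a product of fibre integrals. All computations of
  pair marginals below are instances: inserting an indicator into a single factor gives the measure of
  a set under the corresponding pair marginal, and no product over the remaining
  coordinates has to be split off.
\<close>

lemma nn_integral_prod_fibres:
  assumes f[measurable]: "\<And>i. i \<in> I \<Longrightarrow> f i \<in> borel_measurable (L i \<Otimes>\<^sub>M LY)"
    and w[measurable]: "w \<in> borel_measurable LY"
  shows "(\<integral>\<^sup>+z. (\<Prod>i\<in>I. f i (T i z)) * w (snd z) \<partial>M)
       = (\<integral>\<^sup>+y. (\<Prod>i\<in>I. \<integral>\<^sup>+x. f i (x, y) \<partial>L i) * w y \<partial>LY)"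
proof -
  have fz: "(\<lambda>z. f i (T i z)) \<in> borel_measurable M" if "i \<in> I" for i
    using that by measurable
  have "(\<integral>\<^sup>+z. (\<Prod>i\<in>I. f i (T i z)) * w (snd z) \<partial>M)
      = (\<integral>\<^sup>+y. \<integral>\<^sup>+x. (\<Prod>i\<in>I. f i (x i, y)) * w y \<partial>PiM I L \<partial>LY)"
    by (subst pair_P.nn_integral_snd[symmetric])
       (auto simp: case_prod_beta intro!: borel_measurable_times_ennreal borel_measurable_prod_ennreal fz)
  also have "\<dots> = (\<integral>\<^sup>+y. (\<Prod>i\<in>I. \<integral>\<^sup>+x. f i (x, y) \<partial>L i) * w y \<partial>LY)"
  proof (rule nn_integral_cong)
    fix y assume y: "y \<in> space LY"
    have m: "(\<lambda>x. f i (x, y)) \<in> borel_measurable (L i)" if "i \<in> I" for i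
      using that y by measurable
    have m2: "(\<lambda>x. f i (x i, y)) \<in> borel_measurable (PiM I L)" if "i \<in> I" for i
      using that y by measurable
    have "(\<integral>\<^sup>+x. (\<Prod>i\<in>I. f i (x i, y)) * w y \<partial>PiM I L) = (\<integral>\<^sup>+x. (\<Prod>i\<in>I. f i (x i, y)) \<partial>PiM I L) * w y"
      by (intro nn_integral_multc borel_measurable_prod_ennreal m2)
    also have "(\<integral>\<^sup>+x. (\<Prod>i\<in>I. f i (x i, y)) \<partial>PiM I L) = (\<Prod>i\<in>I. \<integral>\<^sup>+x. f i (x, y) \<partial>L i)"
      by (intro product_nn_integral_prod finite_I m)
    finally show "(\<integral>\<^sup>+x. (\<Prod>i\<in>I. f i (x i, y)) * w y \<partial>PiM I L) = (\<Prod>i\<in>I. \<integral>\<^sup>+x. f i (x, y) \<partial>L i) * w y" .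
  qed
  finally show ?thesis .
qed

lemma distr_T:
  assumes i: "i \<in> I"
  shows "distr M (L i \<Otimes>\<^sub>M LY) (T i)
       = scale_measure (\<Prod>j\<in>I - {i}. emeasure (L j) (space (L j))) (L i \<Otimes>\<^sub>M LY)"
proof (rule measure_eqI)
  fix A assume "A \<in> sets (distr M (L i \<Otimes>\<^sub>M LY) (T i))"
  then have A[measurable]: "A \<in> sets (L i \<Otimes>\<^sub>M LY)" by simp
  define f :: "'i \<Rightarrow> 'a \<times> 'b \<Rightarrow> ennreal" where "f = (\<lambda>j. if j = i then indicator A else (\<lambda>_. 1))"
  have fm: "f j \<in> borel_measurable (L j \<Otimes>\<^sub>M LY)" for j
    using A by (cases "j = i") (auto simp: f_def)
  have "emeasure (distr M (L i \<Otimes>\<^sub>M LY) (T i)) A = (\<integral>\<^sup>+z. indicator A (T i z) \<partial>M)"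
    using i by (subst nn_integral_indicator[symmetric]) (auto simp: nn_integral_distr simp del: nn_integral_indicator)
  also have "\<dots> = (\<integral>\<^sup>+z. (\<Prod>j\<in>I. f j (T j z)) * 1 \<partial>M)"
    using i finite_I by (intro nn_integral_cong) (simp add: f_def prod.remove[of I i])
  also have "\<dots> = (\<integral>\<^sup>+y. (\<Prod>j\<in>I. \<integral>\<^sup>+x. f j (x, y) \<partial>L j) * 1 \<partial>LY)"
    by (rule nn_integral_prod_fibres) (auto intro: fm)
  also have "\<dots> = (\<integral>\<^sup>+y. (\<Prod>j\<in>I - {i}. emeasure (L j) (space (L j))) * (\<integral>\<^sup>+x. indicator A (x, y) \<partial>L i) \<partial>LY)"
    using i finite_I by (intro nn_integral_cong) (simp add: f_def prod.remove[of I i] mult.commute)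
  also have "\<dots> = (\<Prod>j\<in>I - {i}. emeasure (L j) (space (L j))) * emeasure (L i \<Otimes>\<^sub>M LY) A"
    by (subst nn_integral_cmult) (auto simp: pair_i.emeasure_pair_measure_alt2 intro!: nn_integral_cong arg_cong2[where f="(*)"] simp flip: pair_i.nn_integral_snd nn_integral_indicator)
  finally show "emeasure (distr M (L i \<Otimes>\<^sub>M LY) (T i)) A
      = emeasure (scale_measure (\<Prod>j\<in>I - {i}. emeasure (L j) (space (L j))) (L i \<Otimes>\<^sub>M LY)) A" by simp
qed simp

text \<open>
  If \<open>p i\<close> are densities on \<open>L i \<Otimes>\<^sub>M LY\<close> with common second marginal \<open>q\<close>, this is the density under
  which the \<open>x\<^sub>i\<close> are conditionally independent given \<open>y\<close>, with conditional densities
  \<open>p\<^sub>i(\<cdot>, y) / q(y)\<close>. For at least two factors it vanishes where \<open>q\<close> does, because division by zero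
  yields zero; for one factor it is the given density.
\<close>

definition glue :: "('i \<Rightarrow> 'a \<times> 'b \<Rightarrow> real) \<Rightarrow> ('b \<Rightarrow> real) \<Rightarrow> ('i \<Rightarrow> 'a) \<times> 'b \<Rightarrow> real" where
  "glue p q z = (\<Prod>i\<in>I. p i (T i z)) / q (snd z) ^ (card I - 1)"

text \<open>
  The constant in the chain rule: the divergence adds the mass of its reference measure to
  \<open>\<integral> p ln p\<close>, and these masses differ between the plan, its pair marginals and the marginal on \<open>Y\<close>.
\<close>

definition entropy_offset :: real where
  "entropy_offset = measure M (space M) - (\<Sum>i\<in>I. measure (L i \<Otimes>\<^sub>M LY) (space (L i \<Otimes>\<^sub>M LY)))
     + (real (card I) - 1) * measure LY (space LY)"

lemma glue_measurable:
  assumes [measurable]: "\<And>i. i \<in> I \<Longrightarrow> p i \<in> borel_measurable (L i \<Otimes>\<^sub>M LY)" "q \<in> borel_measurable LY"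
  shows "glue p q \<in> borel_measurable M"
proof -
  have "(\<lambda>z. p i (T i z)) \<in> borel_measurable M" if "i \<in> I" for i
    using that by measurable
  then show ?thesis
    unfolding glue_def[abs_def] by (intro borel_measurable_divide borel_measurable_prod) auto
qed

lemma glue_pos_ln:
  assumes p: "\<forall>i\<in>I. 0 < p i (T i z)" and q: "0 < q (snd z)"
  shows "0 < glue p q z"
    and "ln (glue p q z) = (\<Sum>i\<in>I. ln (p i (T i z))) - (real (card I) - 1) * ln (q (snd z))"
proof -
  have card: "1 \<le> card I" using finite_I nonempty_I by (simp add: Suc_le_eq card_gt_0_iff)
  have pos: "0 < (\<Prod>i\<in>I. p i (T i z))" using p by (intro prod_pos) auto
  show "0 < glue p q z" unfolding glue_def using pos q by simp
  have "ln (\<Prod>i\<in>I. p i (T i z)) = (\<Sum>i\<in>I. ln (p i (T i z)))"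
    using p by (intro ln_prod finite_I) auto
  moreover have "ln (glue p q z) = ln (\<Prod>i\<in>I. p i (T i z)) - ln (q (snd z) ^ (card I - 1))"
    unfolding glue_def using pos q by (simp add: ln_div)
  moreover have "ln (q (snd z) ^ (card I - 1)) = (real (card I) - 1) * ln (q (snd z))"
    using q card by (simp add: ln_realpow of_nat_diff)
  ultimately show "ln (glue p q z) = (\<Sum>i\<in>I. ln (p i (T i z))) - (real (card I) - 1) * ln (q (snd z))" by simp
qed

text \<open>
  Integrating out \<open>x\<^sub>j\<close> for \<open>j \<noteq> i\<close> yields a factor \<open>q y\<close> each, which cancels the denominator.
\<close>

lemma distr_glue:
  assumes p[measurable]: "\<And>i. i \<in> I \<Longrightarrow> p i \<in> borel_measurable (L i \<Otimes>\<^sub>M LY)" and q[measurable]: "q \<in> borel_measurable LY"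
    and pnn: "\<And>i z. i \<in> I \<Longrightarrow> 0 \<le> p i z" and qnn: "\<And>y. 0 \<le> q y"
    and fib: "\<And>i. i \<in> I \<Longrightarrow> AE y in LY. (\<integral>\<^sup>+x. ennreal (p i (x, y)) \<partial>L i) = ennreal (q y)"
    and i: "i \<in> I"
  shows "distr (density M (\<lambda>z. ennreal (glue p q z))) (L i \<Otimes>\<^sub>M LY) (T i)
       = density (L i \<Otimes>\<^sub>M LY) (\<lambda>z. ennreal (p i z))"
proof (rule measure_eqI)
  note gm[measurable] = glue_measurable[OF p q, simplified]
  note pi[measurable] = p[OF i]
  fix A assume "A \<in> sets (distr (density M (\<lambda>z. ennreal (glue p q z))) (L i \<Otimes>\<^sub>M LY) (T i))"
  then have A[measurable]: "A \<in> sets (L i \<Otimes>\<^sub>M LY)" by simp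
  define f :: "'i \<Rightarrow> 'a \<times> 'b \<Rightarrow> ennreal"
    where "f = (\<lambda>j z. ennreal (p j z) * (if j = i then indicator A z else 1))"
  define w :: "'b \<Rightarrow> ennreal" where "w = (\<lambda>y. ennreal (1 / q y ^ (card I - 1)))"
  have fm: "f j \<in> borel_measurable (L j \<Otimes>\<^sub>M LY)" if "j \<in> I" for j
    using A p[OF that] by (cases "j = i") (auto simp: f_def)
  have wm: "w \<in> borel_measurable LY" unfolding w_def by measurable
  have "emeasure (distr (density M (\<lambda>z. ennreal (glue p q z))) (L i \<Otimes>\<^sub>M LY) (T i)) A
      = (\<integral>\<^sup>+z. indicator A (T i z) \<partial>density M (\<lambda>z. ennreal (glue p q z)))"
    using i by (subst nn_integral_indicator[symmetric]) (auto simp: nn_integral_distr simp del: nn_integral_indicator)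
  also have "\<dots> = (\<integral>\<^sup>+z. ennreal (glue p q z) * indicator A (T i z) \<partial>M)"
    using i by (subst nn_integral_density) auto
  also have "\<dots> = (\<integral>\<^sup>+z. (\<Prod>j\<in>I. f j (T j z)) * w (snd z) \<partial>M)"
  proof (intro nn_integral_cong)
    fix z
    have "(\<Prod>j\<in>I. f j (T j z)) = (\<Prod>j\<in>I. ennreal (p j (T j z))) * (\<Prod>j\<in>I. if j = i then indicator A (T j z) else 1)"
      unfolding f_def by (rule prod.distrib)
    also have "(\<Prod>j\<in>I. if j = i then indicator A (T j z) else 1) = (indicator A (T i z) :: ennreal)"
      using i finite_I by (simp add: prod.delta')
    also have "(\<Prod>j\<in>I. ennreal (p j (T j z))) = ennreal (\<Prod>j\<in>I. p j (T j z))"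
      by (intro prod_ennreal pnn)
    finally have "(\<Prod>j\<in>I. f j (T j z)) * w (snd z)
        = (ennreal (\<Prod>j\<in>I. p j (T j z)) * w (snd z)) * indicator A (T i z)"
      by (simp add: ac_simps)
    also have "ennreal (\<Prod>j\<in>I. p j (T j z)) * w (snd z) = ennreal (glue p q z)"
      unfolding w_def glue_def by (subst ennreal_mult[symmetric]) (auto intro!: prod_nonneg pnn simp: qnn)
    finally show "ennreal (glue p q z) * indicator A (T i z) = (\<Prod>j\<in>I. f j (T j z)) * w (snd z)" by simp
  qed
  also have "\<dots> = (\<integral>\<^sup>+y. (\<Prod>j\<in>I. \<integral>\<^sup>+x. f j (x, y) \<partial>L j) * w y \<partial>LY)"
    by (rule nn_integral_prod_fibres) (auto intro: fm wm)
  also have "\<dots> = (\<integral>\<^sup>+y. \<integral>\<^sup>+x. f i (x, y) \<partial>L i \<partial>LY)"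
  proof (rule nn_integral_cong_AE)
    have "AE y in LY. \<forall>j\<in>I. (\<integral>\<^sup>+x. ennreal (p j (x, y)) \<partial>L j) = ennreal (q y)"
      using fib finite_I by (simp add: AE_finite_all)
    then show "AE y in LY. (\<Prod>j\<in>I. \<integral>\<^sup>+x. f j (x, y) \<partial>L j) * w y = (\<integral>\<^sup>+x. f i (x, y) \<partial>L i)"
    proof eventually_elim
      case (elim y)
      have "(\<Prod>j\<in>I. \<integral>\<^sup>+x. f j (x, y) \<partial>L j) = (\<integral>\<^sup>+x. f i (x, y) \<partial>L i) * (\<Prod>j\<in>I - {i}. \<integral>\<^sup>+x. f j (x, y) \<partial>L j)"
        by (rule prod.remove[OF finite_I i])
      also have "(\<Prod>j\<in>I - {i}. \<integral>\<^sup>+x. f j (x, y) \<partial>L j) = (\<Prod>j\<in>I - {i}. ennreal (q y))"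
        using elim by (intro prod.cong) (auto simp: f_def)
      also have "\<dots> = ennreal (q y ^ (card I - 1))"
        using i finite_I by (simp add: ennreal_power qnn)
      finally have *: "(\<Prod>j\<in>I. \<integral>\<^sup>+x. f j (x, y) \<partial>L j) * w y
          = (\<integral>\<^sup>+x. f i (x, y) \<partial>L i) * (ennreal (q y ^ (card I - 1)) * w y)" by (simp add: ac_simps)
      show ?case
      \<comment> \<open>Where \<open>q\<close> vanishes, the fibre of \<open>p i\<close> has mass zero, so both sides are zero.\<close>
      proof (cases "q y = 0")
        case True
        have "(\<integral>\<^sup>+x. f i (x, y) \<partial>L i) \<le> (\<integral>\<^sup>+x. ennreal (p i (x, y)) \<partial>L i)"
          by (intro nn_integral_mono) (auto simp: f_def indicator_def)
        also have "\<dots> = 0" using elim i True by simp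
        finally show ?thesis using * by simp
      next
        case False
        have "ennreal (q y ^ (card I - 1)) * w y = ennreal (q y ^ (card I - 1) * (1 / q y ^ (card I - 1)))"
          unfolding w_def by (rule ennreal_mult[symmetric]) (auto simp: qnn)
        also have "\<dots> = 1" using False by simp
        finally show ?thesis using * by simp
      qed
    qed
  qed
  also have "\<dots> = (\<integral>\<^sup>+z. ennreal (p i z) * indicator A z \<partial>(L i \<Otimes>\<^sub>M LY))"
    using fm[OF i] by (subst pair_i.nn_integral_snd) (auto simp: f_def)
  also have "\<dots> = emeasure (density (L i \<Otimes>\<^sub>M LY) (\<lambda>z. ennreal (p i z))) A"
    by (simp add: emeasure_density)
  finally show "emeasure (distr (density M (\<lambda>z. ennreal (glue p q z))) (L i \<Otimes>\<^sub>M LY) (T i)) A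
      = emeasure (density (L i \<Otimes>\<^sub>M LY) (\<lambda>z. ennreal (p i z))) A" .
qed simp

text \<open>
  Gibbs' inequality for the plan against the glued density \<open>h\<close> of its own pair marginals. Both have
  the same mass, and \<open>ln (p / h) \<ge> 1 - h / p\<close>; integrating against the plan gives
  \<open>\<integral> ln p \<ge> \<integral> ln h\<close>, and \<open>ln h\<close> splits into the logarithms of the marginal densities.
\<close>

lemma KL_ge_sum_pair_marginals:
  assumes \<pi>: "\<pi> \<in> M_plus M" and fin: "KL \<pi> M \<noteq> \<infinity>"
  obtains k kY where "\<And>i. i \<in> I \<Longrightarrow> KL (distr \<pi> (L i \<Otimes>\<^sub>M LY) (T i)) (L i \<Otimes>\<^sub>M LY) = ereal (k i)"
    "KL (distr \<pi> LY snd) LY = ereal kY"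
    "ereal ((\<Sum>i\<in>I. k i) - (real (card I) - 1) * kY + entropy_offset) \<le> KL \<pi> M"
proof -
  interpret m: finite_measure \<pi> using \<pi> by (simp add: M_plus_def)
  have sets[measurable_cong]: "sets \<pi> = sets M" using \<pi> by (simp add: M_plus_def)
  have space: "space \<pi> = space M" using sets by (rule sets_eq_imp_space_eq)
  obtain p where p[measurable]: "p \<in> borel_measurable M" and pnn: "\<And>z. 0 \<le> p z"
    and d: "\<pi> = density M (\<lambda>z. ennreal (p z))" and ip: "integrable \<pi> (\<lambda>z. ln (p z))"
    using KL_finite_density[OF finite_M \<pi> fin] by blast
  let ?\<pi> = "\<lambda>i. distr \<pi> (L i \<Otimes>\<^sub>M LY) (T i)"
  have "\<exists>g :: 'a \<times> 'b \<Rightarrow> real. g \<in> borel_measurable (L i \<Otimes>\<^sub>M LY) \<and> (\<forall>z. 0 \<le> g z)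
      \<and> ?\<pi> i = density (L i \<Otimes>\<^sub>M LY) (\<lambda>z. ennreal (g z)) \<and> integrable (?\<pi> i) (\<lambda>z. ln (g z))"
    if "i \<in> I" for i
  proof -
    have "(\<Prod>j\<in>I - {i}. emeasure (L j) (space (L j))) < \<infinity>"
      by (simp add: ennreal_prod_eq_top less_top[symmetric])
    then show ?thesis
      by (rule KL_finite_distr[OF finite_M finite_Mi T_measurable[OF that] distr_T[OF that] _ \<pi> fin]) blast
  qed
  then have "\<forall>i\<in>I. \<exists>g :: 'a \<times> 'b \<Rightarrow> real. g \<in> borel_measurable (L i \<Otimes>\<^sub>M LY) \<and> (\<forall>z. 0 \<le> g z)
      \<and> ?\<pi> i = density (L i \<Otimes>\<^sub>M LY) (\<lambda>z. ennreal (g z)) \<and> integrable (?\<pi> i) (\<lambda>z. ln (g z))"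
    by blast
  from bchoice[OF this] obtain g :: "'i \<Rightarrow> 'a \<times> 'b \<Rightarrow> real" where G: "\<forall>i\<in>I. g i \<in> borel_measurable (L i \<Otimes>\<^sub>M LY) \<and> (\<forall>z. 0 \<le> g i z)
      \<and> ?\<pi> i = density (L i \<Otimes>\<^sub>M LY) (\<lambda>z. ennreal (g i z)) \<and> integrable (?\<pi> i) (\<lambda>z. ln (g i z))"
    by blast
  have g: "\<And>i. i \<in> I \<Longrightarrow> g i \<in> borel_measurable (L i \<Otimes>\<^sub>M LY)" and gnn: "\<And>i z. i \<in> I \<Longrightarrow> 0 \<le> g i z"
    and gd: "\<And>i. i \<in> I \<Longrightarrow> ?\<pi> i = density (L i \<Otimes>\<^sub>M LY) (\<lambda>z. ennreal (g i z))"
    and gi: "\<And>i. i \<in> I \<Longrightarrow> integrable (?\<pi> i) (\<lambda>z. ln (g i z))"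
    using G by blast+
  note [measurable] = g
  let ?\<xi> = "distr \<pi> LY snd"
  have sn: "distr M LY snd = scale_measure (emeasure (PiM I L) (space (PiM I L))) LY"
    by (rule distr_snd_pair[OF finite_PiM finite_LY])
  have "emeasure (PiM I L) (space (PiM I L)) < \<infinity>" by (simp add: less_top[symmetric])
  then obtain q :: "'b \<Rightarrow> real" where q[measurable]: "q \<in> borel_measurable LY" and qnn: "\<And>y. 0 \<le> q y"
    and qd: "?\<xi> = density LY (\<lambda>y. ennreal (q y))" and iq: "integrable ?\<xi> (\<lambda>y. ln (q y))"
    by (rule KL_finite_distr[OF finite_M finite_LY measurable_snd sn _ \<pi> fin]) blast
  have fmi: "finite_measure (?\<pi> i)" if "i \<in> I" for i
    using that by (intro m.finite_measure_distr) measurable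
  have fxi: "finite_measure ?\<xi>" by (intro m.finite_measure_distr) measurable
  have pre_snd: "snd -` space LY \<inter> space M = space M" by (auto simp: space_pair_measure)
  have pre: "T i -` space (L i \<Otimes>\<^sub>M LY) \<inter> space M = space M" if "i \<in> I" for i
    using that by (auto simp: space_pair_measure space_PiM)
  have m_i: "measure (?\<pi> i) (space (?\<pi> i)) = measure \<pi> (space \<pi>)" if "i \<in> I" for i
    using that by (simp add: measure_distr space pre)
  have m_xi: "measure ?\<xi> (space ?\<xi>) = measure \<pi> (space \<pi>)"
    by (simp add: measure_distr space pre_snd)
  have fib: "AE y in LY. (\<integral>\<^sup>+x. ennreal (g i (x, y)) \<partial>L i) = ennreal (q y)" if i: "i \<in> I" for i
  proof (rule AE_fibre_integral_eq)
    have "distr (?\<pi> i) LY snd = ?\<xi>" using i by (subst distr_distr) (auto simp: comp_def)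
    then show "distr (density (L i \<Otimes>\<^sub>M LY) (\<lambda>z. ennreal (g i z))) LY snd = density LY (\<lambda>y. ennreal (q y))"
      using gd[OF i] qd by simp
  qed (use g[OF i] in \<open>auto intro: Li.sigma_finite_measure_axioms Y.sigma_finite_measure_axioms\<close>)
  let ?h = "glue g q"
  have h[measurable]: "?h \<in> borel_measurable M" by (rule glue_measurable) (auto intro: g)
  have hnn: "0 \<le> ?h z" for z unfolding glue_def by (intro divide_nonneg_nonneg prod_nonneg zero_le_power qnn gnn)
  obtain i0 where i0: "i0 \<in> I" using nonempty_I by blast
  have hM: "(\<integral>\<^sup>+z. ennreal (?h z) \<partial>M) = emeasure \<pi> (space \<pi>)"
  proof -
    have *: "T i0 -` space (L i0 \<Otimes>\<^sub>M LY) \<inter> space M = space M"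
      using i0 by (auto simp: space_pair_measure space_PiM)
    have "(\<integral>\<^sup>+z. ennreal (?h z) \<partial>M) = emeasure (density M (\<lambda>z. ennreal (?h z))) (space M)"
      by (simp add: emeasure_density cong: nn_integral_cong)
    also have "\<dots> = emeasure (distr (density M (\<lambda>z. ennreal (?h z))) (L i0 \<Otimes>\<^sub>M LY) (T i0)) (space (L i0 \<Otimes>\<^sub>M LY))"
      using i0 * by (simp add: emeasure_distr)
    also have "\<dots> = emeasure (?\<pi> i0) (space (L i0 \<Otimes>\<^sub>M LY))"
      using distr_glue[OF g q gnn qnn fib i0] gd[OF i0] by simp
    also have "\<dots> = emeasure \<pi> (space \<pi>)"
      using i0 * by (simp add: emeasure_distr space)
    finally show ?thesis .
  qed
  have hint: "integrable M ?h" using hM by (intro integrableI_nonneg) (auto simp: hnn less_top[symmetric])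
  have hmass: "(\<integral>z. ?h z \<partial>M) = measure \<pi> (space \<pi>)"
    using hM by (subst integral_eq_nn_integral) (auto simp: hnn measure_def)
  have pp: "AE z in \<pi>. 0 < p z" unfolding d by (rule AE_density_pos[OF p pnn])
  have gp: "AE z in \<pi>. \<forall>i\<in>I. 0 < g i (T i z)"
  proof -
    have "AE z in \<pi>. 0 < g i (T i z)" if i: "i \<in> I" for i
    proof -
      have "AE z in ?\<pi> i. 0 < g i z" unfolding gd[OF i] by (rule AE_density_pos[OF g[OF i] gnn[OF i]])
      then show ?thesis using i g[OF i] by (subst (asm) AE_distr_iff) auto
    qed
    then show ?thesis using finite_I by (simp add: AE_finite_all)
  qed
  have qp: "AE z in \<pi>. 0 < q (snd z)"
  proof -
    have "AE y in ?\<xi>. 0 < q y" unfolding qd by (rule AE_density_pos[OF q qnn])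
    then show ?thesis by (subst (asm) AE_distr_iff) auto
  qed
  have ig': "integrable \<pi> (\<lambda>z. ln (g i (T i z)))" if i: "i \<in> I" for i
    using gi[OF i] i g[OF i] by (subst (asm) integrable_distr_eq) auto
  have iq': "integrable \<pi> (\<lambda>z. ln (q (snd z)))"
    using iq by (subst (asm) integrable_distr_eq) auto
  have rint: "integrable M (\<lambda>z. p z * (?h z / p z))"
    by (rule Bochner_Integration.integrable_bound[OF hint]) (auto simp: hnn pnn)
  have ir: "integrable \<pi> (\<lambda>z. ?h z / p z)"
    unfolding d using rint by (subst integrable_density) (auto simp: pnn)
  have "(\<integral>z. ?h z / p z \<partial>\<pi>) = (\<integral>z. p z * (?h z / p z) \<partial>M)"
    unfolding d by (subst integral_density) (auto simp: pnn)
  also have "\<dots> \<le> (\<integral>z. ?h z \<partial>M)"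
    by (intro integral_mono rint hint) (auto simp: hnn)
  finally have rle: "(\<integral>z. ?h z / p z \<partial>\<pi>) \<le> measure \<pi> (space \<pi>)" using hmass by simp
  let ?R = "\<lambda>z. ln (p z) - (\<Sum>i\<in>I. ln (g i (T i z))) + (real (card I) - 1) * ln (q (snd z))"
  have iR: "integrable \<pi> ?R" using ip ig' iq' by auto
  have "0 \<le> measure \<pi> (space \<pi>) - (\<integral>z. ?h z / p z \<partial>\<pi>)" using rle by simp
  also have "\<dots> = (\<integral>z. 1 - ?h z / p z \<partial>\<pi>)" using ir by simp
  also have "\<dots> \<le> (\<integral>z. ?R z \<partial>\<pi>)"
  proof (rule integral_mono_AE)
    show "AE z in \<pi>. 1 - ?h z / p z \<le> ?R z"
      using pp gp qp
    proof eventually_elim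
      case (elim z)
      note h_z = glue_pos_ln[of g z q, OF elim(2,3)]
      have "ln (?h z / p z) \<le> ?h z / p z - 1" using h_z(1) elim by (intro ln_le_minus_one) simp
      then show ?case using h_z elim by (simp add: ln_div)
    qed
  qed (use ir iR in auto)
  also have "\<dots> = (\<integral>z. ln (p z) \<partial>\<pi>) - (\<Sum>i\<in>I. \<integral>z. ln (g i (T i z)) \<partial>\<pi>)
       + (real (card I) - 1) * (\<integral>z. ln (q (snd z)) \<partial>\<pi>)"
    using ip ig' iq' by simp
  also have "(\<Sum>i\<in>I. \<integral>z. ln (g i (T i z)) \<partial>\<pi>) = (\<Sum>i\<in>I. \<integral>z. ln (g i z) \<partial>?\<pi> i)"
    using g by (intro sum.cong refl integral_distr[symmetric]) auto
  also have "(\<integral>z. ln (q (snd z)) \<partial>\<pi>) = (\<integral>y. ln (q y) \<partial>?\<xi>)"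
    by (intro integral_distr[symmetric]) auto
  finally have main: "0 \<le> (\<integral>z. ln (p z) \<partial>\<pi>) - (\<Sum>i\<in>I. \<integral>z. ln (g i z) \<partial>?\<pi> i)
       + (real (card I) - 1) * (\<integral>y. ln (q y) \<partial>?\<xi>)" .
  define k where "k i = (\<integral>z. ln (g i z) \<partial>?\<pi> i) + measure (L i \<Otimes>\<^sub>M LY) (space (L i \<Otimes>\<^sub>M LY)) - measure \<pi> (space \<pi>)" for i
  define kY where "kY = (\<integral>y. ln (q y) \<partial>?\<xi>) + measure LY (space LY) - measure \<pi> (space \<pi>)"
  have k: "KL (?\<pi> i) (L i \<Otimes>\<^sub>M LY) = ereal (k i)" if i: "i \<in> I" for i
    using KL_density[OF finite_Mi g[OF i] gnn[OF i] gd[OF i] fmi[OF i] gi[OF i]] m_i[OF i] by (simp add: k_def)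
  have kY: "KL ?\<xi> LY = ereal kY"
    using KL_density[OF finite_LY q qnn qd fxi iq] m_xi by (simp add: kY_def)
  have "(\<Sum>i\<in>I. k i) - (real (card I) - 1) * kY + entropy_offset
     = (\<Sum>i\<in>I. \<integral>z. ln (g i z) \<partial>?\<pi> i) - (real (card I) - 1) * (\<integral>y. ln (q y) \<partial>?\<xi>)
       + measure M (space M) - measure \<pi> (space \<pi>)"
    unfolding k_def kY_def entropy_offset_def by (simp add: sum.distrib sum_subtractf algebra_simps)
  then have "ereal ((\<Sum>i\<in>I. k i) - (real (card I) - 1) * kY + entropy_offset) \<le> KL \<pi> M"
    using main KL_density[OF finite_M p pnn d m.finite_measure_axioms ip] by simp
  with k kY show ?thesis by (rule that)
qed

text \<open>
  Equality in \<open>KL_ge_sum_pair_marginals\<close> for the conditionally independent plan: its log-density is the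
  sum of the marginal log-densities, each of which is integrated through its marginal.
\<close>

lemma KL_of_glued_plan:
  assumes \<pi>: "\<And>i. i \<in> I \<Longrightarrow> \<pi> i \<in> M_plus (L i \<Otimes>\<^sub>M LY)" 
    and fin: "\<And>i. i \<in> I \<Longrightarrow> KL (\<pi> i) (L i \<Otimes>\<^sub>M LY) = ereal (k i)"
    and \<xi>: "\<And>i. i \<in> I \<Longrightarrow> distr (\<pi> i) LY snd = \<xi>"
  obtains \<rho> kY where "\<rho> \<in> M_plus M" "\<And>i. i \<in> I \<Longrightarrow> distr \<rho> (L i \<Otimes>\<^sub>M LY) (T i) = \<pi> i"
    "KL \<xi> LY = ereal kY" "KL \<rho> M = ereal ((\<Sum>i\<in>I. k i) - (real (card I) - 1) * kY + entropy_offset)"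
proof -
  have "\<exists>g :: 'a \<times> 'b \<Rightarrow> real. g \<in> borel_measurable (L i \<Otimes>\<^sub>M LY) \<and> (\<forall>z. 0 \<le> g z)
      \<and> \<pi> i = density (L i \<Otimes>\<^sub>M LY) (\<lambda>z. ennreal (g z)) \<and> integrable (\<pi> i) (\<lambda>z. ln (g z))"
    if "i \<in> I" for i
    by (rule KL_finite_density[OF finite_Mi \<pi>[OF that]]) (use fin[OF that] in auto)
  then have "\<forall>i\<in>I. \<exists>g :: 'a \<times> 'b \<Rightarrow> real. g \<in> borel_measurable (L i \<Otimes>\<^sub>M LY) \<and> (\<forall>z. 0 \<le> g z)
      \<and> \<pi> i = density (L i \<Otimes>\<^sub>M LY) (\<lambda>z. ennreal (g z)) \<and> integrable (\<pi> i) (\<lambda>z. ln (g z))"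
    by blast
  from bchoice[OF this] obtain g :: "'i \<Rightarrow> 'a \<times> 'b \<Rightarrow> real" where G: "\<forall>i\<in>I. g i \<in> borel_measurable (L i \<Otimes>\<^sub>M LY) \<and> (\<forall>z. 0 \<le> g i z)
      \<and> \<pi> i = density (L i \<Otimes>\<^sub>M LY) (\<lambda>z. ennreal (g i z)) \<and> integrable (\<pi> i) (\<lambda>z. ln (g i z))"
    by blast
  have g: "\<And>i. i \<in> I \<Longrightarrow> g i \<in> borel_measurable (L i \<Otimes>\<^sub>M LY)" and gnn: "\<And>i z. i \<in> I \<Longrightarrow> 0 \<le> g i z"
    and gd: "\<And>i. i \<in> I \<Longrightarrow> \<pi> i = density (L i \<Otimes>\<^sub>M LY) (\<lambda>z. ennreal (g i z))"
    and gi: "\<And>i. i \<in> I \<Longrightarrow> integrable (\<pi> i) (\<lambda>z. ln (g i z))"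
    using G by blast+
  note [measurable] = g
  have fmi: "finite_measure (\<pi> i)" if "i \<in> I" for i using \<pi>[OF that] by (simp add: M_plus_def)
  have si: "sets (\<pi> i) = sets (L i \<Otimes>\<^sub>M LY)" if "i \<in> I" for i using \<pi>[OF that] by (simp add: M_plus_def)
  obtain i0 where i0: "i0 \<in> I" using nonempty_I by blast
  have "emeasure (L i0) (space (L i0)) < \<infinity>" by (simp add: less_top[symmetric])
  moreover have "KL (\<pi> i0) (L i0 \<Otimes>\<^sub>M LY) \<noteq> \<infinity>" using fin[OF i0] by simp
  ultimately obtain q :: "'b \<Rightarrow> real" where q[measurable]: "q \<in> borel_measurable LY" and qnn: "\<And>y. 0 \<le> q y"
    and qd: "\<xi> = density LY (\<lambda>y. ennreal (q y))" and iq: "integrable \<xi> (\<lambda>y. ln (q y))"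
    by (rule KL_finite_distr[OF finite_Mi finite_LY measurable_snd distr_snd_pair[OF finite_L finite_LY] _ \<pi>[OF i0],
          unfolded \<xi>[OF i0]]) blast
  have fxi: "finite_measure \<xi>" 
    unfolding \<xi>[OF i0, symmetric] using measurable_cong_sets[OF si[OF i0] refl]
    by (intro finite_measure.finite_measure_distr fmi i0) auto
  have sxi[measurable_cong]: "sets \<xi> = sets LY" by (simp add: qd)
  have fib: "AE y in LY. (\<integral>\<^sup>+x. ennreal (g i (x, y)) \<partial>L i) = ennreal (q y)" if i: "i \<in> I" for i
    by (rule AE_fibre_integral_eq)
      (use g[OF i] \<xi>[OF i] gd[OF i] qd in \<open>auto intro: Li.sigma_finite_measure_axioms Y.sigma_finite_measure_axioms\<close>)
  have pre_snd: "snd -` space LY \<inter> space M = space M" by (auto simp: space_pair_measure)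
  let ?h = "glue g q"
  have h[measurable]: "?h \<in> borel_measurable M" by (rule glue_measurable) (auto intro: g)
  have hnn: "0 \<le> ?h z" for z unfolding glue_def by (intro divide_nonneg_nonneg prod_nonneg zero_le_power qnn gnn)
  define \<rho> where "\<rho> = density M (\<lambda>z. ennreal (?h z))"
  have sr[measurable_cong]: "sets \<rho> = sets M" by (simp add: \<rho>_def)
  have space: "space \<rho> = space M" by (simp add: \<rho>_def)
  have marg: "distr \<rho> (L i \<Otimes>\<^sub>M LY) (T i) = \<pi> i" if i: "i \<in> I" for i
    using distr_glue[OF g q gnn qnn fib i] gd[OF i] by (simp add: \<rho>_def)
  have marg_xi: "distr \<rho> LY snd = \<xi>"
  proof -
    have "distr (distr \<rho> (L i0 \<Otimes>\<^sub>M LY) (T i0)) LY snd = distr \<rho> LY snd"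
      using i0 by (subst distr_distr) (auto simp: comp_def)
    then show ?thesis using marg[OF i0] \<xi>[OF i0] by simp
  qed
  have pre: "T i -` space (L i \<Otimes>\<^sub>M LY) \<inter> space \<rho> = space \<rho>" if "i \<in> I" for i
    using that by (auto simp: space space_pair_measure space_PiM)
  have em: "emeasure (\<pi> i) (space (\<pi> i)) = emeasure \<rho> (space \<rho>)" if i: "i \<in> I" for i
    unfolding marg[OF i, symmetric] using i pre[OF i] by (simp add: emeasure_distr)
  have fr: "finite_measure \<rho>"
    using em[OF i0] finite_measure.emeasure_finite[OF fmi[OF i0], of "space (\<pi> i0)"] by (intro finite_measureI) simp
  have m_i: "measure (\<pi> i) (space (\<pi> i)) = measure \<rho> (space \<rho>)" if "i \<in> I" for i
    using em[OF that] by (simp add: measure_def)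
  have m_xi: "measure \<xi> (space \<xi>) = measure \<rho> (space \<rho>)"
    unfolding marg_xi[symmetric] by (simp add: measure_distr space pre_snd)
  have gp: "AE z in \<rho>. \<forall>i\<in>I. 0 < g i (T i z)"
  proof -
    have "AE z in \<rho>. 0 < g i (T i z)" if i: "i \<in> I" for i
    proof -
      have "AE z in distr \<rho> (L i \<Otimes>\<^sub>M LY) (T i). 0 < g i z"
        unfolding marg[OF i] gd[OF i] by (rule AE_density_pos[OF g[OF i] gnn[OF i]])
      then show ?thesis using i g[OF i] by (subst (asm) AE_distr_iff) auto
    qed
    then show ?thesis using finite_I by (simp add: AE_finite_all)
  qed
  have qp: "AE z in \<rho>. 0 < q (snd z)"
  proof -
    have "AE y in distr \<rho> LY snd. 0 < q y" unfolding marg_xi unfolding qd by (rule AE_density_pos[OF q qnn])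
    then show ?thesis by (subst (asm) AE_distr_iff) auto
  qed
  have ig': "integrable \<rho> (\<lambda>z. ln (g i (T i z)))" if i: "i \<in> I" for i
    using gi[OF i] i g[OF i] unfolding marg[OF i, symmetric] by (subst (asm) integrable_distr_eq) auto
  have iq': "integrable \<rho> (\<lambda>z. ln (q (snd z)))"
    using iq unfolding marg_xi[symmetric] by (subst (asm) integrable_distr_eq) auto
  let ?R = "\<lambda>z. (\<Sum>i\<in>I. ln (g i (T i z))) - (real (card I) - 1) * ln (q (snd z))"
  have lnh: "AE z in \<rho>. ?R z = ln (?h z)"
    using gp qp
  proof eventually_elim
    case (elim z)
    show ?case using glue_pos_ln(2)[of g z q, OF elim] by simp
  qed
  have iR: "integrable \<rho> ?R" using ig' iq' by auto
  have ih: "integrable \<rho> (\<lambda>z. ln (?h z))"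
    using iR by (rule integrable_cong_AE_imp) (use lnh in \<open>auto elim: eventually_mono\<close>)
  have "(\<integral>z. ln (?h z) \<partial>\<rho>) = (\<integral>z. ?R z \<partial>\<rho>)"
    using lnh iR ih by (intro integral_cong_AE) (auto elim: eventually_mono)
  also have "\<dots> = (\<Sum>i\<in>I. \<integral>z. ln (g i (T i z)) \<partial>\<rho>) - (real (card I) - 1) * (\<integral>z. ln (q (snd z)) \<partial>\<rho>)"
    using ig' iq' by simp
  also have "(\<Sum>i\<in>I. \<integral>z. ln (g i (T i z)) \<partial>\<rho>) = (\<Sum>i\<in>I. \<integral>z. ln (g i z) \<partial>\<pi> i)"
    unfolding marg[symmetric] using g marg by (intro sum.cong refl) (auto simp: integral_distr simp flip: marg)
  also have "(\<integral>z. ln (q (snd z)) \<partial>\<rho>) = (\<integral>y. ln (q y) \<partial>\<xi>)"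
    unfolding marg_xi[symmetric] by (intro integral_distr[symmetric]) auto
  finally have main: "(\<integral>z. ln (?h z) \<partial>\<rho>)
      = (\<Sum>i\<in>I. \<integral>z. ln (g i z) \<partial>\<pi> i) - (real (card I) - 1) * (\<integral>y. ln (q y) \<partial>\<xi>)" .
  define kY where "kY = (\<integral>y. ln (q y) \<partial>\<xi>) + measure LY (space LY) - measure \<rho> (space \<rho>)"
  have k: "k i = (\<integral>z. ln (g i z) \<partial>\<pi> i) + measure (L i \<Otimes>\<^sub>M LY) (space (L i \<Otimes>\<^sub>M LY)) - measure \<rho> (space \<rho>)"
    if i: "i \<in> I" for i
    using KL_density[OF finite_Mi g[OF i] gnn[OF i] gd[OF i] fmi[OF i] gi[OF i]] m_i[OF i] fin[OF i] by simp
  have kY: "KL \<xi> LY = ereal kY"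
    using KL_density[OF finite_LY q qnn qd fxi iq] m_xi by (simp add: kY_def)
  have sum_k: "(\<Sum>i\<in>I. k i) = (\<Sum>i\<in>I. \<integral>z. ln (g i z) \<partial>\<pi> i)
      + (\<Sum>i\<in>I. measure (L i \<Otimes>\<^sub>M LY) (space (L i \<Otimes>\<^sub>M LY))) - real (card I) * measure \<rho> (space \<rho>)"
    using k by (simp add: sum.distrib sum_subtractf)
  have "(\<Sum>i\<in>I. k i) - (real (card I) - 1) * kY + entropy_offset
     = (\<integral>z. ln (?h z) \<partial>\<rho>) + measure M (space M) - measure \<rho> (space \<rho>)"
    unfolding main kY_def entropy_offset_def sum_k by (simp add: algebra_simps)
  then have "KL \<rho> M = ereal ((\<Sum>i\<in>I. k i) - (real (card I) - 1) * kY + entropy_offset)"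
    using KL_density[OF finite_M h hnn \<rho>_def fr ih] by simp
  moreover have "\<rho> \<in> M_plus M" using fr sr by (simp add: M_plus_def)
  ultimately show ?thesis using marg kY by (intro that) auto
qed

end

section \<open>Divergences of entropy functions\<close>

text \<open>
  Lower semicontinuity makes the strict superlevel sets open.
\<close>

lemma Gamma0_borel_measurable:
  assumes "\<phi> \<in> Gamma0"
  shows "\<phi> \<in> borel_measurable borel"
proof (rule borel_measurableI_greater)
  fix a :: ereal
  have "open {x. a < \<phi> x}"
  proof (subst open_subopen, intro ballI)
    fix x assume "x \<in> {x. a < \<phi> x}"
    then have x: "a < \<phi> x" by simp
    also have "\<phi> x \<le> Liminf (at x) \<phi>" using assms by (simp add: Gamma0_def)
    finally have "eventually (\<lambda>y. a < \<phi> y) (at x)" by (rule less_LiminfD)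
    then obtain S where "open S" "x \<in> S" "\<forall>y\<in>S. y \<noteq> x \<longrightarrow> a < \<phi> y"
      by (auto simp: eventually_at_topological)
    then show "\<exists>T. open T \<and> x \<in> T \<and> T \<subseteq> {x. a < \<phi> x}" using x by (intro exI[of _ S]) auto
  qed
  then show "{x \<in> space borel. a < \<phi> x} \<in> sets borel" by simp
qed

text \<open>
  Convexity between \<open>1\<close>, where \<open>\<phi>\<close> vanishes, and \<open>y\<close> gives
  \<open>\<phi> x \<le> (x - 1) / (y - 1) * \<phi> y \<le> x / y * \<phi> y\<close>. Monotonicity guarantees that the limit
  in the definition of \<open>recession\<close> exists.
\<close>

lemma entropy_function_quotient_mono:
  assumes \<phi>: "entropy_function \<phi>" and xy: "1 \<le> x" "x \<le> y"
  shows "\<phi> x / ereal x \<le> \<phi> y / ereal y"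
proof (cases "x = 1")
  case True
  have "0 \<le> \<phi> y / ereal y" using \<phi> xy by (intro zero_le_divide_ereal) (auto simp: entropy_function_def)
  moreover have "\<phi> 1 = 0" using \<phi> by (simp add: entropy_function_def)
  ultimately show ?thesis using True by simp
next
  case False
  then have x: "1 < x" and y: "1 < y" using xy by auto
  define u where "u = (x - 1) / (y - 1)"
  have u: "0 \<le> u" "u \<le> 1" using x xy y by (auto simp: u_def)
  have conv: "\<phi> (u * y + (1 - u) * 1) \<le> ereal u * \<phi> y + ereal (1 - u) * \<phi> 1"
    using \<phi> u unfolding entropy_function_def Gamma0_def by blast
  have "u * (y - 1) = x - 1" using y by (simp add: u_def)
  then have "u * y + (1 - u) * 1 = x" by (simp add: algebra_simps)
  moreover have "\<phi> 1 = 0" using \<phi> by (simp add: entropy_function_def)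
  ultimately have le: "\<phi> x \<le> ereal u * \<phi> y" using conv by simp
  have nn: "0 \<le> \<phi> x" "0 \<le> \<phi> y" using \<phi> by (auto simp: entropy_function_def)
  show ?thesis
  proof (cases "\<phi> y")
    case (real r)
    then have r: "0 \<le> r" using nn by simp
    obtain s where s: "\<phi> x = ereal s" using le nn real by (cases "\<phi> x") auto
    have "s \<le> u * r" using le s real by simp
    also have "\<dots> \<le> x / y * r"
      using x y xy r by (intro mult_right_mono) (auto simp: u_def field_simps)
    finally have "s / x \<le> r / y" using x y by (simp add: field_simps)
    then show ?thesis using s real x y by simp
  qed (use nn y in auto)
qed

lemma recession_limit:
  assumes \<phi>: "entropy_function \<phi>"
  shows "((\<lambda>x. \<phi> x / ereal x) \<longlongrightarrow> recession \<phi>) at_top" and "0 \<le> recession \<phi>"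
proof -
  let ?g = "\<lambda>x. \<phi> x / ereal x"
  define l where "l = (SUP x\<in>{1..}. ?g x)"
  have lim: "(?g \<longlongrightarrow> l) at_top"
  proof (rule order_tendstoI)
    fix a assume "a < l"
    then obtain x0 where x0: "1 \<le> x0" "a < ?g x0" unfolding l_def less_SUP_iff by auto
    have "a < ?g x" if "x0 \<le> x" for x
      using x0 entropy_function_quotient_mono[OF \<phi> x0(1) that] by (rule_tac less_le_trans) auto
    then show "eventually (\<lambda>x. a < ?g x) at_top" unfolding eventually_at_top_linorder by blast
  next
    fix a assume a: "l < a"
    have "?g x < a" if "1 \<le> x" for x
      using a by (rule le_less_trans[rotated]) (auto simp: l_def that intro: SUP_upper)
    then show "eventually (\<lambda>x. ?g x < a) at_top" unfolding eventually_at_top_linorder by blast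
  qed
  then have "recession \<phi> = l" unfolding recession_def by (intro tendsto_Lim) auto
  then show "(?g \<longlongrightarrow> recession \<phi>) at_top" using lim by simp
  have "0 = ?g 1" using \<phi> by (simp add: entropy_function_def)
  also have "\<dots> \<le> l" unfolding l_def by (rule SUP_upper) simp
  finally have "0 \<le> l" .
  then show "0 \<le> recession \<phi>" using \<open>recession \<phi> = l\<close> by simp
qed

lemma recession_scale:
  assumes \<phi>: "entropy_function \<phi>"
  shows "recession (\<lambda>s. ereal t * \<phi> s) = ereal t * recession \<phi>"
proof -
  have "((\<lambda>x. ereal t * (\<phi> x / ereal x)) \<longlongrightarrow> ereal t * recession \<phi>) at_top"
    by (intro tendsto_cmult_ereal recession_limit \<phi>) auto
  then have "((\<lambda>x. ereal t * \<phi> x / ereal x) \<longlongrightarrow> ereal t * recession \<phi>) at_top"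
    by (simp add: divide_ereal_def mult.assoc)
  then show ?thesis unfolding recession_def by (intro tendsto_Lim) auto
qed

lemma sum_of_finite_measures:
  assumes "finite_measure \<mu>" "finite_measure \<nu>" and sets: "sets \<mu> = sets \<nu>"
  obtains \<rho> where "finite_measure \<rho>" "sets \<rho> = sets \<nu>"
    "\<And>A. A \<in> sets \<nu> \<Longrightarrow> emeasure \<rho> A = emeasure \<mu> A + emeasure \<nu> A"
proof -
  let ?\<rho> = "measure_of (space \<nu>) (sets \<nu>) (\<lambda>A. emeasure \<mu> A + emeasure \<nu> A)"
  have em: "emeasure ?\<rho> A = emeasure \<mu> A + emeasure \<nu> A" if "A \<in> sets \<nu>" for A
  proof (rule emeasure_measure_of_sigma)
    show "countably_additive (sets \<nu>) (\<lambda>A. emeasure \<mu> A + emeasure \<nu> A)"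
    proof (rule countably_additiveI)
      fix A :: "nat \<Rightarrow> 'a set" assume A: "range A \<subseteq> sets \<nu>" "disjoint_family A"
      have "(\<Sum>i. emeasure \<mu> (A i) + emeasure \<nu> (A i)) = (\<Sum>i. emeasure \<mu> (A i)) + (\<Sum>i. emeasure \<nu> (A i))"
        by (intro suminf_add[symmetric]) auto
      then show "(\<Sum>i. emeasure \<mu> (A i) + emeasure \<nu> (A i)) = emeasure \<mu> (\<Union>i. A i) + emeasure \<nu> (\<Union>i. A i)"
        using A sets by (simp add: suminf_emeasure)
    qed
  qed (use that in \<open>auto simp: positive_def sets.sigma_algebra_axioms\<close>)
  have "finite_measure ?\<rho>"
  proof (rule finite_measureI)
    show "emeasure ?\<rho> (space ?\<rho>) \<noteq> \<infinity>"
      using assms em[OF sets.top] finite_measure.emeasure_finite by (auto simp: space_measure_of_conv)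
  qed
  with em show ?thesis by (intro that[of ?\<rho>]) (auto simp: sets.sigma_sets_eq)
qed

text \<open>
  Take densities \<open>f\<close> of \<open>\<mu>\<close> and \<open>g\<close> of \<open>\<nu>\<close> with respect to \<open>\<mu> + \<nu>\<close>. Off the \<open>\<nu>\<close>-null set \<open>S = {g = 0}\<close>
  the measure \<open>\<mu>\<close> has density \<open>f / g\<close> with respect to \<open>\<nu>\<close>; its restriction to \<open>S\<close> is singular.
\<close>

lemma lebesgue_decomposition_exists:
  assumes fin: "finite_measure \<mu>" "finite_measure \<nu>" and sets: "sets \<mu> = sets \<nu>"
  obtains \<sigma> \<mu>s where "lebesgue_decomposition \<mu> \<nu> \<sigma> \<mu>s"
proof -
  interpret m: finite_measure \<mu> by fact
  interpret n: finite_measure \<nu> by fact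
  obtain \<rho> where \<rho>: "finite_measure \<rho>" and s\<rho>: "sets \<rho> = sets \<nu>"
    and em: "\<And>A. A \<in> sets \<nu> \<Longrightarrow> emeasure \<rho> A = emeasure \<mu> A + emeasure \<nu> A"
    using sum_of_finite_measures[OF assms] by blast
  interpret r: finite_measure \<rho> by fact
  note [measurable_cong] = s\<rho> sets
  have ac: "absolutely_continuous \<rho> \<mu>" "absolutely_continuous \<rho> \<nu>"
    using em sets s\<rho> by (auto simp: absolutely_continuous_def null_sets_def)
  define f where "f x = enn2real (RN_deriv \<rho> \<mu> x)" for x
  define g where "g x = enn2real (RN_deriv \<rho> \<nu> x)" for x
  have [measurable]: "f \<in> borel_measurable \<nu>" "g \<in> borel_measurable \<nu>"
    unfolding f_def[abs_def] g_def[abs_def] using borel_measurable_RN_deriv[of \<rho>] s\<rho>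
    by (auto cong: measurable_cong_sets)
  have fg: "0 \<le> f x" "0 \<le> g x" for x by (auto simp: f_def g_def)
  have df: "\<mu> = density \<rho> (\<lambda>x. ennreal (f x))"
    unfolding f_def by (rule density_real_RN_deriv) (use \<rho> fin ac s\<rho> sets in auto)
  have dg: "\<nu> = density \<rho> (\<lambda>x. ennreal (g x))"
    unfolding g_def by (rule density_real_RN_deriv) (use \<rho> fin ac s\<rho> in auto)
  define S where "S = {x\<in>space \<nu>. g x = 0}"
  have S[measurable]: "S \<in> sets \<nu>" unfolding S_def by measurable
  define \<sigma> where "\<sigma> x = f x / g x" for x
  have \<sigma>[measurable]: "\<sigma> \<in> borel_measurable \<nu>" unfolding \<sigma>_def[abs_def] by measurable
  define \<mu>s where "\<mu>s = density \<mu> (indicator S)"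
  have "emeasure (density \<rho> (\<lambda>x. ennreal (g x))) A = (\<integral>\<^sup>+x. ennreal (g x) * indicator A x \<partial>\<rho>)"
    if "A \<in> sets \<nu>" for A
    using that by (intro emeasure_density) (auto simp: s\<rho>)
  then have dg_em: "emeasure \<nu> A = (\<integral>\<^sup>+x. ennreal (g x) * indicator A x \<partial>\<rho>)" if "A \<in> sets \<nu>" for A
    using that unfolding dg[symmetric] by blast
  have "(\<integral>\<^sup>+x. h x \<partial>density \<rho> (\<lambda>x. ennreal (g x))) = (\<integral>\<^sup>+x. ennreal (g x) * h x \<partial>\<rho>)"
    if [measurable]: "h \<in> borel_measurable \<nu>" for h
    by (rule nn_integral_density) measurable
  then have dg_nn: "(\<integral>\<^sup>+x. h x \<partial>\<nu>) = (\<integral>\<^sup>+x. ennreal (g x) * h x \<partial>\<rho>)"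
    if "h \<in> borel_measurable \<nu>" for h
    using that unfolding dg[symmetric] by blast
  have "emeasure (density \<rho> (\<lambda>x. ennreal (f x))) A = (\<integral>\<^sup>+x. ennreal (f x) * indicator A x \<partial>\<rho>)"
    if "A \<in> sets \<nu>" for A
    using that by (intro emeasure_density) (auto simp: s\<rho>)
  then have df_em: "emeasure \<mu> A = (\<integral>\<^sup>+x. ennreal (f x) * indicator A x \<partial>\<rho>)" if "A \<in> sets \<nu>" for A
    using that unfolding df[symmetric] by blast
  have eS: "emeasure \<nu> S = 0"
  proof -
    have "emeasure \<nu> S = (\<integral>\<^sup>+x. ennreal (g x) * indicator S x \<partial>\<rho>)"
      unfolding dg_em[OF S] ..
    also have "\<dots> = (\<integral>\<^sup>+x. 0 \<partial>\<rho>)" by (intro nn_integral_cong) (auto simp: S_def indicator_def)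
    finally show ?thesis by simp
  qed
  have "emeasure \<mu> A = emeasure (density \<nu> (\<lambda>x. ennreal (\<sigma> x))) A + emeasure \<mu>s A" if A[measurable]: "A \<in> sets \<nu>" for A
  proof -
    have "emeasure \<mu>s A = (\<integral>\<^sup>+x. indicator S x * indicator A x \<partial>\<mu>)"
      unfolding \<mu>s_def by (rule emeasure_density) (auto simp: sets)
    also have "\<dots> = (\<integral>\<^sup>+x. indicator (A \<inter> S) x \<partial>\<mu>)"
      by (intro nn_integral_cong) (auto simp: indicator_def)
    also have "\<dots> = emeasure \<mu> (A \<inter> S)" by (rule nn_integral_indicator) (auto simp: sets)
    finally have e1: "emeasure \<mu>s A = emeasure \<mu> (A \<inter> S)" .
    have "emeasure (density \<nu> (\<lambda>x. ennreal (\<sigma> x))) A = (\<integral>\<^sup>+x. ennreal (\<sigma> x) * indicator A x \<partial>\<nu>)"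
      by (simp add: emeasure_density)
    also have "\<dots> = (\<integral>\<^sup>+x. ennreal (g x) * (ennreal (\<sigma> x) * indicator A x) \<partial>\<rho>)"
      by (rule dg_nn) measurable
    also have "\<dots> = (\<integral>\<^sup>+x. ennreal (f x) * indicator (A - S) x \<partial>\<rho>)"
    proof (rule nn_integral_cong)
      fix x assume "x \<in> space \<rho>"
      then have "x \<in> space \<nu>" using sets_eq_imp_space_eq[OF s\<rho>] by simp
      then show "ennreal (g x) * (ennreal (\<sigma> x) * indicator A x) = ennreal (f x) * indicator (A - S) x"
        using fg[of x] by (auto simp: S_def \<sigma>_def indicator_def ennreal_mult[symmetric])
    qed
    also have "\<dots> = emeasure \<mu> (A - S)"
      by (rule df_em[symmetric]) measurable
    finally have e2: "emeasure (density \<nu> (\<lambda>x. ennreal (\<sigma> x))) A = emeasure \<mu> (A - S)" .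
    have "emeasure \<mu> (A - S) + emeasure \<mu> (A \<inter> S) = emeasure \<mu> ((A - S) \<union> (A \<inter> S))"
      by (rule plus_emeasure) (auto simp: sets)
    also have "(A - S) \<union> (A \<inter> S) = A" by auto
    finally show ?thesis using e1 e2 by simp
  qed
  moreover have "emeasure \<mu>s (space \<nu> - S) = 0"
  proof -
    have "emeasure \<mu>s (space \<nu> - S) = (\<integral>\<^sup>+x. indicator S x * indicator (space \<nu> - S) x \<partial>\<mu>)"
      unfolding \<mu>s_def by (rule emeasure_density) (auto simp: sets)
    also have "\<dots> = (\<integral>\<^sup>+x. 0 \<partial>\<mu>)" by (intro nn_integral_cong) (auto simp: indicator_def)
    finally show ?thesis by simp
  qed
  ultimately have "lebesgue_decomposition \<mu> \<nu> \<sigma> \<mu>s"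
    using eS S \<sigma> fg sets by (auto simp: lebesgue_decomposition_def \<sigma>_def \<mu>s_def)
  then show ?thesis by (rule that)
qed

text \<open>
  One decomposition serves all \<open>\<phi>\<close>, because the choice in \<open>D\<close> does not involve \<open>\<phi>\<close>; this is what
  allows \<open>D (t \<phi>)\<close> and \<open>D \<phi>\<close> to be compared.
\<close>

lemma D_unfold:
  assumes "finite_measure \<mu>" "finite_measure \<nu>" "sets \<mu> = sets \<nu>"
  obtains \<sigma> \<mu>s where "lebesgue_decomposition \<mu> \<nu> \<sigma> \<mu>s"
    "\<And>\<phi>. D \<phi> \<mu> \<nu> = enn2ereal (\<integral>\<^sup>+x. e2ennreal (\<phi> (\<sigma> x)) \<partial>\<nu>) + recession \<phi> * enn2ereal (emeasure \<mu>s (space \<mu>s))"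
proof -
  obtain \<sigma>0 \<mu>0 where "lebesgue_decomposition \<mu> \<nu> \<sigma>0 \<mu>0"
    using lebesgue_decomposition_exists[OF assms] by blast
  then have "case (\<sigma>0, \<mu>0) of (\<sigma>, \<mu>s) \<Rightarrow> lebesgue_decomposition \<mu> \<nu> \<sigma> \<mu>s" by simp
  then have *: "case (SOME (\<sigma>, \<mu>s). lebesgue_decomposition \<mu> \<nu> \<sigma> \<mu>s) of (\<sigma>, \<mu>s) \<Rightarrow> lebesgue_decomposition \<mu> \<nu> \<sigma> \<mu>s"
    by (rule someI)
  obtain \<sigma> \<mu>s where eq: "(SOME (\<sigma>, \<mu>s). lebesgue_decomposition \<mu> \<nu> \<sigma> \<mu>s) = (\<sigma>, \<mu>s)" by fastforce
  show ?thesis by (rule that[of \<sigma> \<mu>s]) (use * eq in \<open>auto simp: D_def\<close>)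
qed

lemma D_nonneg:
  assumes "entropy_function \<phi>"
  shows "0 \<le> D \<phi> \<mu> \<nu>"
  using recession_limit(2)[OF assms] by (auto simp: D_def split: prod.split)

lemma D_scale:
  assumes \<phi>: "entropy_function \<phi>" and t: "0 \<le> t"
    and \<mu>\<nu>: "finite_measure \<mu>" "finite_measure \<nu>" "sets \<mu> = sets \<nu>"
  shows "D (\<lambda>s. ereal t * \<phi> s) \<mu> \<nu> = ereal t * D \<phi> \<mu> \<nu>"
proof -
  obtain \<sigma> \<mu>s where dec: "lebesgue_decomposition \<mu> \<nu> \<sigma> \<mu>s"
    and D: "\<And>\<phi>. D \<phi> \<mu> \<nu> = enn2ereal (\<integral>\<^sup>+x. e2ennreal (\<phi> (\<sigma> x)) \<partial>\<nu>) + recession \<phi> * enn2ereal (emeasure \<mu>s (space \<mu>s))"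
    using D_unfold[OF \<mu>\<nu>] by blast
  have [measurable]: "\<sigma> \<in> borel_measurable \<nu>" using dec by (simp add: lebesgue_decomposition_def)
  have [measurable]: "\<phi> \<in> borel_measurable borel"
    using \<phi> by (intro Gamma0_borel_measurable) (simp add: entropy_function_def)
  have scale: "ereal t * enn2ereal a = enn2ereal (ennreal t * a)" for a
    using t by (simp add: times_ennreal.rep_eq enn2ereal_ennreal)
  have "e2ennreal (ereal t * \<phi> s) = ennreal t * e2ennreal (\<phi> s)" for s
  proof -
    have "\<phi> s = enn2ereal (e2ennreal (\<phi> s))" using \<phi> by (simp add: enn2ereal_e2ennreal entropy_function_def)
    then have "ereal t * \<phi> s = enn2ereal (ennreal t * e2ennreal (\<phi> s))" by (metis scale)
    then show ?thesis by simp
  qed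
  then have "enn2ereal (\<integral>\<^sup>+x. e2ennreal (ereal t * \<phi> (\<sigma> x)) \<partial>\<nu>) = ereal t * enn2ereal (\<integral>\<^sup>+x. e2ennreal (\<phi> (\<sigma> x)) \<partial>\<nu>)"
    by (simp add: nn_integral_cmult scale)
  then show ?thesis
    using recession_limit(2)[OF \<phi>] by (simp add: D recession_scale[OF \<phi>] ereal_right_distrib mult.assoc)
qed

lemma recession_iota: "recession (iota {1}) = \<infinity>"
  unfolding recession_def
proof (rule tendsto_Lim)
  have "eventually (\<lambda>x. iota {1} x / ereal x = \<infinity>) at_top"
    using eventually_gt_at_top[of 1] by eventually_elim (auto simp: iota_def)
  then show "((\<lambda>x. iota {1} x / ereal x) \<longlongrightarrow> \<infinity>) at_top"
    by (rule tendsto_eventually)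
qed simp

text \<open>
  A finite value forces the absolutely continuous part to have density \<open>1\<close> and, as the recession
  constant is infinite, the singular part to vanish. Conversely, in a decomposition of \<open>\<nu>\<close> with
  respect to itself the singular part is concentrated on a null set of \<open>\<nu>\<close>, so it is zero.
\<close>

lemma D_iota:
  assumes \<mu>\<nu>: "finite_measure \<mu>" "finite_measure \<nu>" "sets \<mu> = sets \<nu>"
  shows "D (iota {1}) \<mu> \<nu> = (if \<mu> = \<nu> then 0 else \<infinity>)"
proof -
  interpret n: finite_measure \<nu> by fact
  obtain \<sigma> \<mu>s where dec: "lebesgue_decomposition \<mu> \<nu> \<sigma> \<mu>s"
    and D: "\<And>\<phi>. D \<phi> \<mu> \<nu> = enn2ereal (\<integral>\<^sup>+x. e2ennreal (\<phi> (\<sigma> x)) \<partial>\<nu>) + recession \<phi> * enn2ereal (emeasure \<mu>s (space \<mu>s))"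
    using D_unfold[OF \<mu>\<nu>] by blast
  have \<sigma>[measurable]: "\<sigma> \<in> borel_measurable \<nu>" and s[measurable_cong]: "sets \<mu>s = sets \<nu>"
    and em: "\<And>A. A \<in> sets \<nu> \<Longrightarrow> emeasure \<mu> A = emeasure (density \<nu> (\<lambda>x. ennreal (\<sigma> x))) A + emeasure \<mu>s A"
    using dec by (auto simp: lebesgue_decomposition_def)
  have snn: "\<And>x. 0 \<le> \<sigma> x" using dec by (auto simp: lebesgue_decomposition_def)
  obtain S where S: "S \<in> sets \<nu>" "emeasure \<nu> S = 0" "emeasure \<mu>s (space \<nu> - S) = 0"
    using dec by (auto simp: lebesgue_decomposition_def)
  have sp: "space \<mu>s = space \<nu>" using s by (rule sets_eq_imp_space_eq)
  have io: "e2ennreal (iota {1} r) = (if r = 1 then 0 else \<infinity>)" for r by (simp add: iota_def e2ennreal_neg)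
  have D1: "D (iota {1}) \<mu> \<nu> = enn2ereal (\<integral>\<^sup>+x. (if \<sigma> x = 1 then 0 else \<infinity>) \<partial>\<nu>) + \<infinity> * enn2ereal (emeasure \<mu>s (space \<mu>s))"
    by (simp add: D recession_iota io)
  have int0: "(\<integral>\<^sup>+x. (if \<sigma> x = 1 then 0 else \<infinity>) \<partial>\<nu>) = (0::ennreal)" if "AE x in \<nu>. \<sigma> x = 1"
  proof -
    have "(\<integral>\<^sup>+x. (if \<sigma> x = 1 then 0 else \<infinity>) \<partial>\<nu>) = (\<integral>\<^sup>+x. (0::ennreal) \<partial>\<nu>)"
      using that by (intro nn_integral_cong_AE) (auto elim!: eventually_mono)
    then show ?thesis by simp
  qed
  show ?thesis
  proof (cases "\<mu> = \<nu>")
    case True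
    have "emeasure \<mu>s S = 0" using em[OF S(1)] S(2) True by simp
    moreover have "emeasure \<mu>s (space \<nu>) \<le> emeasure \<mu>s (space \<nu> - S) + emeasure \<mu>s S"
    proof -
      have "space \<nu> = (space \<nu> - S) \<union> S" using sets.sets_into_space[OF S(1)] by auto
      then show ?thesis using emeasure_subadditive[of "space \<nu> - S" \<mu>s S] S(1) s by auto
    qed
    ultimately have z: "emeasure \<mu>s (space \<nu>) = 0" using S(3) by simp
    then have z': "emeasure \<mu>s A = 0" if "A \<in> sets \<nu>" for A
      using emeasure_mono[of A "space \<nu>" \<mu>s] sets.sets_into_space[OF that] s by auto
    have "density \<nu> (\<lambda>x. ennreal (\<sigma> x)) = density \<nu> (\<lambda>x. 1)"
      by (rule measure_eqI) (use em z' True in \<open>auto simp: density_1\<close>)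
    then have "AE x in \<nu>. ennreal (\<sigma> x) = 1" by (intro n.density_unique) auto
    then have "AE x in \<nu>. \<sigma> x = 1" by (auto elim!: eventually_mono)
    then show ?thesis using True z D1 int0 by (simp add: sp zero_ennreal.rep_eq)
  next
    case False
    have "D (iota {1}) \<mu> \<nu> = \<infinity>"
    proof (rule ccontr)
      assume *: "D (iota {1}) \<mu> \<nu> \<noteq> \<infinity>"
      have z: "emeasure \<mu>s (space \<nu>) = 0"
      proof (rule ccontr)
        assume "emeasure \<mu>s (space \<nu>) \<noteq> 0"
        then have "0 < enn2ereal (emeasure \<mu>s (space \<nu>))" 
          by (simp add: zero_less_iff_neq_zero flip: zero_ennreal.rep_eq less_ennreal.rep_eq)
        then have "\<infinity> * enn2ereal (emeasure \<mu>s (space \<nu>)) = \<infinity>" by simp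
        then show False using * D1 sp by simp
      qed
      then have z': "emeasure \<mu>s A = 0" if "A \<in> sets \<nu>" for A
        using emeasure_mono[of A "space \<nu>" \<mu>s] sets.sets_into_space[OF that] s by auto
      have "(\<integral>\<^sup>+x. (if \<sigma> x = 1 then 0 else \<infinity>) \<partial>\<nu>) \<noteq> (\<infinity>::ennreal)"
        using * D1 by auto
      then have "AE x in \<nu>. (if \<sigma> x = 1 then 0 else \<infinity>) \<noteq> (\<infinity>::ennreal)"
        by (intro nn_integral_PInf_AE) auto
      then have "AE x in \<nu>. ennreal (\<sigma> x) = 1" by (auto elim!: eventually_mono split: if_splits)
      then have "density \<nu> (\<lambda>x. ennreal (\<sigma> x)) = density \<nu> (\<lambda>x. 1)" by (intro density_cong) auto
      then have "\<mu> = \<nu>" using em z' \<mu>\<nu>(3) by (intro measure_eqI) (auto simp: density_1)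
      with False show False by simp
    qed
    then show ?thesis using False by simp
  qed
qed

section \<open>Finite and compact base spaces\<close>

text \<open>
  Points of \<open>\<real>\<^sup>d\<close> are extensional functions on \<open>{..<d}\<close>. Extending them by zero embeds \<open>\<real>\<^sup>d\<close> into the
  type \<open>nat \<Rightarrow> real\<close>, which is a second countable topological space and so brings Borel sets along.
\<close>

definition zero_ext :: "nat \<Rightarrow> (nat \<Rightarrow> real) \<Rightarrow> nat \<Rightarrow> real" where
  "zero_ext d x = (\<lambda>i. if i < d then x i else 0)"

lemma restrict_zero_ext: "x \<in> extensional {..<d} \<Longrightarrow> restrict (zero_ext d x) {..<d} = x"
  by (auto simp: zero_ext_def extensional_def restrict_def fun_eq_iff)

lemma zero_ext_measurable: "zero_ext d \<in> borel_measurable (\<Pi>\<^sub>M i\<in>{..<d}. lborel)"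
proof (rule measurable_coordinatewise_then_product)
  fix i
  show "(\<lambda>x. zero_ext d x i) \<in> borel_measurable (\<Pi>\<^sub>M i\<in>{..<d}. lborel)"
    by (cases "i < d") (auto simp: zero_ext_def)
qed

lemma continuous_map_restrict_lessThan:
  "continuous_map euclidean (powertop_real {..<d}) (\<lambda>z::nat \<Rightarrow> real. restrict z {..<d})"
  by (subst continuous_map_componentwise) (auto intro!: continuous_intros continuous_on_product_coordinates)

text \<open>
  A compact set is closed, and its preimage under the continuous restriction map is closed in
  \<open>nat \<Rightarrow> real\<close>; pulling that back along the measurable embedding returns the set.
\<close>

lemma compact_set_measurable:
  fixes d :: nat
  assumes K: "compactin (powertop_real {..<d}) K"
  shows "K \<in> sets (\<Pi>\<^sub>M i\<in>{..<d}. lborel)"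
proof -
  let ?C = "{z \<in> topspace euclidean. restrict z {..<d} \<in> K}"
  have KE: "K \<subseteq> extensional {..<d}"
    using compactin_subset_topspace[OF K] by (auto simp: PiE_def)
  have "closedin (powertop_real {..<d}) K"
    using K by (intro compactin_imp_closedin) (auto simp: Hausdorff_space_product_topology)
  then have "closedin euclidean ?C"
    by (rule closedin_continuous_map_preimage[OF continuous_map_restrict_lessThan])
  then have "?C \<in> sets borel" by (intro borel_closed) simp
  then have "zero_ext d -` ?C \<inter> space (\<Pi>\<^sub>M i\<in>{..<d}. lborel) \<in> sets (\<Pi>\<^sub>M i\<in>{..<d}. lborel)"
    by (rule measurable_sets[OF zero_ext_measurable])
  also have "zero_ext d -` ?C \<inter> space (\<Pi>\<^sub>M i\<in>{..<d}. lborel) = K"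
    using KE by (auto simp: space_PiM PiE_def restrict_zero_ext)
  finally show ?thesis .
qed

lemma compact_set_finite_measure:
  fixes d :: nat
  assumes K: "compactin (powertop_real {..<d}) K"
  shows "finite_measure (restrict_space (\<Pi>\<^sub>M i\<in>{..<d}. lborel) K)"
proof (rule finite_measureI)
  let ?P = "\<Pi>\<^sub>M i\<in>{..<d}. (lborel :: real measure)"
  interpret product_sigma_finite "\<lambda>_::nat. lborel :: real measure" ..
  have KE: "K \<subseteq> extensional {..<d}"
    using compactin_subset_topspace[OF K] by (auto simp: PiE_def)
  have "\<exists>b. \<forall>x\<in>K. \<bar>x i\<bar> \<le> b" if "i < d" for i
  proof -
    have "compactin euclideanreal ((\<lambda>x. x i) ` K)"
      using K that by (intro image_compactin[where X="powertop_real {..<d}"] continuous_map_product_projection) auto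
    then have "bounded ((\<lambda>x. x i) ` K)" by (simp add: compact_imp_bounded)
    then show ?thesis by (auto simp: bounded_iff)
  qed
  then have "\<forall>i\<in>{..<d}. \<exists>b. \<forall>x\<in>K. \<bar>x i\<bar> \<le> b" by auto
  from bchoice[OF this] obtain b where b: "\<forall>i\<in>{..<d}. \<forall>x\<in>K. \<bar>x i\<bar> \<le> b i" by blast
  have sub: "K \<subseteq> PiE {..<d} (\<lambda>i. {- b i..b i})"
  proof
    fix x assume x: "x \<in> K"
    have "- b i \<le> x i \<and> x i \<le> b i" if "i < d" for i
    proof -
      have "\<bar>x i\<bar> \<le> b i" using b x that by blast
      then show ?thesis by linarith
    qed
    then show "x \<in> PiE {..<d} (\<lambda>i. {- b i..b i})" using x KE by (auto simp: PiE_def)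
  qed
  have "emeasure ?P K \<le> emeasure ?P (PiE {..<d} (\<lambda>i. {- b i..b i}))"
    by (intro emeasure_mono sub) (auto intro!: sets_PiM_I_finite)
  also have "\<dots> = (\<Prod>i<d. emeasure lborel {- b i..b i})"
    by (intro emeasure_PiM) auto
  also have "\<dots> < \<infinity>" by (auto simp: less_top[symmetric] ennreal_prod_eq_top emeasure_lborel_Icc_eq)
  finally have "emeasure ?P K \<noteq> \<infinity>" by simp
  moreover have "K \<subseteq> space ?P" using sets.sets_into_space[OF compact_set_measurable[OF K]] .
  ultimately show "emeasure (restrict_space ?P K) (space (restrict_space ?P K)) \<noteq> \<infinity>"
    using compact_set_measurable[OF K]
    by (simp add: space_restrict_space emeasure_restrict_space Int_absorb2)
qed

lemma space_ref:
  assumes "admissible S"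
  shows "space (ref S) = topspace (top_of S)"
proof (cases S)
  case (Compact_Set d K)
  then have "compactin (powertop_real {..<d}) K" using assms by simp
  then have "K \<subseteq> topspace (powertop_real {..<d})" by (rule compactin_subset_topspace)
  then show ?thesis
    using Compact_Set by (auto simp: space_embed_measure space_restrict_space topspace_pullback_topology space_PiM)
qed simp

lemma finite_measure_ref:
  assumes "admissible S"
  shows "finite_measure (ref S)"
proof (cases S)
  case (Finite_Set A)
  then show ?thesis using assms by (auto intro: finite_measure_count_space)
next
  case (Compact_Set d K)
  interpret finite_measure "restrict_space (\<Pi>\<^sub>M i\<in>{..<d}. lborel) K"
    using assms Compact_Set by (intro compact_set_finite_measure) auto
  show ?thesis
    using Compact_Set by (auto intro!: finite_measureI simp: emeasure_embed_measure)
qed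

lemma compact_space_top_of:
  fixes S :: "'p base_space"
  assumes "admissible S"
  shows "compact_space (top_of S)"
proof (cases S)
  case (Finite_Set A)
  then show ?thesis using assms by (auto simp: compact_space_discrete_topology)
next
  case (Compact_Set d K)
  let ?T = "powertop_real {..<d}"
  have K: "compactin ?T K" using assms Compact_Set by simp
  have sub: "K \<subseteq> topspace ?T" by (rule compactin_subset_topspace[OF K])
  have cont: "continuous_map (subtopology ?T K) (pullback_topology (Inr ` K) projr ?T) (Inr :: _ \<Rightarrow> 'p pt)"
    unfolding continuous_map_def
  proof (intro conjI allI impI)
    show "Inr \<in> topspace (subtopology ?T K) \<rightarrow> topspace (pullback_topology (Inr ` K) projr ?T)"
      using sub by (auto simp: topspace_pullback_topology)
    fix U :: "'p pt set" assume "openin (pullback_topology (Inr ` K) projr ?T) U"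
    then obtain W where W: "openin ?T W" "U = projr -` W \<inter> Inr ` K" by (auto simp: openin_pullback_topology)
    have "{x \<in> topspace (subtopology ?T K). Inr x \<in> U} = W \<inter> K"
      using W sub by auto
    then show "openin (subtopology ?T K) {x \<in> topspace (subtopology ?T K). Inr x \<in> U}"
      using W(1) by (auto simp: openin_subtopology)
  qed
  have "compactin (subtopology ?T K) K" using K by simp
  then have "compactin (pullback_topology (Inr ` K) projr ?T) ((Inr :: _ \<Rightarrow> 'p pt) ` K)"
    using cont by (rule image_compactin)
  moreover have "topspace (pullback_topology (Inr ` K) projr ?T) = (Inr :: _ \<Rightarrow> 'p pt) ` K"
    using sub by (auto simp: topspace_pullback_topology)
  ultimately show ?thesis using Compact_Set by (simp add: compact_space_def)
qed

text \<open>
  Both kinds of spaces admit a measurable map into the second countable space \<open>nat \<Rightarrow> real\<close> that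
  induces their topology. For a finite space any injective numbering will do.
\<close>

lemma ref_embedding:
  fixes S :: "'p base_space"
  assumes "admissible S"
  shows "\<exists>h :: 'p pt \<Rightarrow> nat \<Rightarrow> real. h \<in> borel_measurable (ref S)
    \<and> (\<forall>U. openin (top_of S) U \<longrightarrow> (\<exists>V. open V \<and> U = h -` V \<inter> topspace (top_of S)))"
proof (cases S)
  case (Finite_Set A)
  then have fin: "finite A" using assms by simp
  define h :: "'p pt \<Rightarrow> nat \<Rightarrow> real" where "h = (\<lambda>p _. real (to_nat_on A (projl p)))"
  have inj: "x = y" if "h x = h y" "x \<in> Inl ` A" "y \<in> Inl ` A" for x y
    using that inj_on_to_nat_on[OF countable_finite[OF fin]] by (auto simp: h_def fun_eq_iff dest: inj_onD)
  show ?thesis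
  proof (intro exI[of _ h] conjI allI impI)
    show "h \<in> borel_measurable (ref S)" by (simp add: Finite_Set)
    fix U assume "openin (top_of S) U"
    then have U: "U \<subseteq> Inl ` A" by (simp add: Finite_Set)
    have "open (- (h ` (Inl ` A - U)))"
      using fin by (intro open_Compl finite_imp_closed) auto
    moreover have "U = h -` (- (h ` (Inl ` A - U))) \<inter> topspace (top_of S)"
      using U by (auto simp: Finite_Set dest!: inj)
    ultimately show "\<exists>V. open V \<and> U = h -` V \<inter> topspace (top_of S)" by blast
  qed
next
  case (Compact_Set d K)
  let ?T = "powertop_real {..<d}"
  have K: "compactin ?T K" using assms Compact_Set by simp
  have sub: "K \<subseteq> topspace ?T" by (rule compactin_subset_topspace[OF K])
  then have KE: "K \<subseteq> extensional {..<d}" by (auto simp: PiE_def)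
  show ?thesis
  proof (intro exI[of _ "\<lambda>p. zero_ext d (projr p)"] conjI allI impI)
    show "(\<lambda>p. zero_ext d (projr p)) \<in> borel_measurable (ref S)"
      unfolding Compact_Set ref.simps
      by (rule measurable_embed_measure1) (auto intro: measurable_restrict_space1 zero_ext_measurable)
    fix U assume "openin (top_of S) U"
    then obtain W where W: "openin ?T W" "U = projr -` W \<inter> Inr ` K"
      by (auto simp: openin_pullback_topology Compact_Set)
    have "openin euclidean {z \<in> topspace euclidean. restrict z {..<d} \<in> W}"
      by (rule openin_continuous_map_preimage[OF continuous_map_restrict_lessThan W(1)])
    then have "open {z. restrict z {..<d} \<in> W}" by simp
    moreover have "U = (\<lambda>p. zero_ext d (projr p)) -` {z. restrict z {..<d} \<in> W} \<inter> topspace (top_of S)"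
      using KE sub by (auto simp: W(2) Compact_Set topspace_pullback_topology restrict_zero_ext subset_iff)
    ultimately show "\<exists>V. open V \<and> U = (\<lambda>p. zero_ext d (projr p)) -` V \<inter> topspace (top_of S)" by blast
  qed
qed

text \<open>
  An open set of the product is the preimage, under the product of the two embeddings, of a union of
  open rectangles. That union is a single open set of a second countable space, hence
  Borel, however many rectangles it takes.
\<close>

lemma continuous_map_borel_measurable:
  assumes X: "admissible X" and Y: "admissible Y"
    and c: "continuous_map (prod_topology (top_of X) (top_of Y)) euclideanreal c"
  shows "c \<in> borel_measurable (ref X \<Otimes>\<^sub>M ref Y)"
proof (rule borel_measurableI)
  fix O' :: "real set" assume "open O'"
  obtain h :: "_ \<Rightarrow> nat \<Rightarrow> real" where "h \<in> borel_measurable (ref X)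
      \<and> (\<forall>U. openin (top_of X) U \<longrightarrow> (\<exists>V. open V \<and> U = h -` V \<inter> topspace (top_of X)))"
    using ref_embedding[OF X] ..
  then have h[measurable]: "h \<in> borel_measurable (ref X)"
    and hU: "openin (top_of X) U \<Longrightarrow> \<exists>V. open V \<and> U = h -` V \<inter> topspace (top_of X)" for U
    by simp_all
  obtain k :: "_ \<Rightarrow> nat \<Rightarrow> real" where "k \<in> borel_measurable (ref Y)
      \<and> (\<forall>U. openin (top_of Y) U \<longrightarrow> (\<exists>V. open V \<and> U = k -` V \<inter> topspace (top_of Y)))"
    using ref_embedding[OF Y] ..
  then have k[measurable]: "k \<in> borel_measurable (ref Y)"
    and kU: "openin (top_of Y) U \<Longrightarrow> \<exists>V. open V \<and> U = k -` V \<inter> topspace (top_of Y)" for U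
    by simp_all
  let ?S = "topspace (top_of X) \<times> topspace (top_of Y)"
  define H where "H = (\<lambda>z. (h (fst z), k (snd z)))"
  have H: "H \<in> borel_measurable (ref X \<Otimes>\<^sub>M ref Y)" unfolding H_def by measurable
  have sp: "space (ref X \<Otimes>\<^sub>M ref Y) = ?S" by (simp add: space_pair_measure space_ref X Y)
  define W where "W = c -` O' \<inter> space (ref X \<Otimes>\<^sub>M ref Y)"
  have "W = {z \<in> topspace (prod_topology (top_of X) (top_of Y)). c z \<in> O'}"
    by (auto simp: W_def sp)
  then have W: "openin (prod_topology (top_of X) (top_of Y)) W"
    using openin_continuous_map_preimage[OF c, of O'] \<open>open O'\<close> by simp
  define V where "V = \<Union>{V1 \<times> V2 | V1 V2. open V1 \<and> open V2 \<and> H -` (V1 \<times> V2) \<inter> ?S \<subseteq> W}"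
  have "open V" unfolding V_def by (intro open_Union) (auto intro: open_Times)
  have "W = H -` V \<inter> ?S"
  proof
    show "H -` V \<inter> ?S \<subseteq> W" unfolding V_def by blast
    show "W \<subseteq> H -` V \<inter> ?S"
    proof clarify
      fix x y assume xy: "(x, y) \<in> W"
      then obtain U1 U2 where U: "openin (top_of X) U1" "openin (top_of Y) U2" "x \<in> U1" "y \<in> U2" "U1 \<times> U2 \<subseteq> W"
        using W[unfolded openin_prod_topology_alt, rule_format, OF xy] by auto
      obtain V1 where V1: "open V1" "U1 = h -` V1 \<inter> topspace (top_of X)" using hU[OF U(1)] by blast
      obtain V2 where V2: "open V2" "U2 = k -` V2 \<inter> topspace (top_of Y)" using kU[OF U(2)] by blast
      have "H -` (V1 \<times> V2) \<inter> ?S \<subseteq> W" using U V1 V2 by (auto simp: H_def)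
      then have "V1 \<times> V2 \<subseteq> V" unfolding V_def using V1 V2 by blast
      then show "(x, y) \<in> H -` V \<inter> ?S" using U V1 V2 by (auto simp: H_def)
    qed
  qed
  moreover have "H -` V \<inter> space (ref X \<Otimes>\<^sub>M ref Y) \<in> sets (ref X \<Otimes>\<^sub>M ref Y)"
    using H \<open>open V\<close> by (intro measurable_sets) auto
  ultimately show "c -` O' \<inter> space (ref X \<Otimes>\<^sub>M ref Y) \<in> sets (ref X \<Otimes>\<^sub>M ref Y)"
    using sp by (simp add: W_def)
qed

lemma continuous_map_bounded:
  assumes X: "admissible X" and Y: "admissible Y"
    and c: "continuous_map (prod_topology (top_of X) (top_of Y)) euclideanreal c"
  obtains b where "\<And>z. z \<in> space (ref X \<Otimes>\<^sub>M ref Y) \<Longrightarrow> \<bar>c z\<bar> \<le> b"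
proof -
  have "compact_space (prod_topology (top_of X) (top_of Y))"
    by (simp add: compact_space_prod_topology compact_space_top_of X Y)
  then have "compactin euclideanreal (c ` topspace (prod_topology (top_of X) (top_of Y)))"
    unfolding compact_space_def using c by (rule image_compactin)
  then have "bounded (c ` (topspace (top_of X) \<times> topspace (top_of Y)))"
    by (simp add: compact_imp_bounded)
  then obtain b where "\<forall>z\<in>topspace (top_of X) \<times> topspace (top_of Y). \<bar>c z\<bar> \<le> b"
    by (auto simp: bounded_iff)
  then show ?thesis by (intro that[of b]) (auto simp: space_pair_measure space_ref X Y)
qed

section \<open>The multi-marginal problem and the barycenter problem\<close>

lemma ereal_cmult_INF:
  assumes "0 < r"
  shows "ereal r * (INF x\<in>A. f x) = (INF x\<in>A. ereal r * f x)"
proof -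
  have "{ereal r * x |x. x \<in> f ` A} = (\<lambda>x. ereal r * f x) ` A" by auto
  then show ?thesis using ereal_Inf_cmult[OF assms, of "\<lambda>x. x \<in> f ` A"] by simp
qed

text \<open>
  The two problems over abstract finite reference measures. The topology of the base spaces
  enters through the measurability and boundedness of the cost functions.
\<close>

locale barycenter_problem = finite_product_spaces I L LY
  for I :: "'i set" and L :: "'i \<Rightarrow> 'a measure" and LY :: "'b measure" +
  fixes \<epsilon> :: real and t :: "'i \<Rightarrow> real" and c :: "'i \<Rightarrow> 'a \<times> 'b \<Rightarrow> real"
    and \<phi> :: "'i \<Rightarrow> real \<Rightarrow> ereal" and \<mu> :: "'i \<Rightarrow> 'a measure"
  assumes eps: "0 < \<epsilon>" and t_nonneg: "\<And>i. i \<in> I \<Longrightarrow> 0 \<le> t i"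
    and c_measurable: "\<And>i. i \<in> I \<Longrightarrow> c i \<in> borel_measurable (L i \<Otimes>\<^sub>M LY)"
    and c_bounded: "\<And>i. i \<in> I \<Longrightarrow> \<exists>b. \<forall>z\<in>space (L i \<Otimes>\<^sub>M LY). \<bar>c i z\<bar> \<le> b"
    and c_nonneg: "\<And>i z. i \<in> I \<Longrightarrow> z \<in> space (L i \<Otimes>\<^sub>M LY) \<Longrightarrow> 0 \<le> c i z"
    and \<phi>: "\<And>i. i \<in> I \<Longrightarrow> entropy_function (\<phi> i)"
    and \<mu>: "\<And>i. i \<in> I \<Longrightarrow> \<mu> i \<in> M_plus (L i)"
begin

definition objective :: "(('i \<Rightarrow> 'a) \<times> 'b) measure \<Rightarrow> ereal" where
  "objective \<pi> = ereal (\<integral>z. (\<Sum>i\<in>I. t i * c i (T i z)) \<partial>\<pi>) + ereal \<epsilon> * KL \<pi> M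
     + (\<Sum>i\<in>I. D (\<lambda>s. ereal (t i) * \<phi> i s) (distr \<pi> (L i) (\<lambda>z. fst z i)) (\<mu> i))"

text \<open>
  The functional whose infimum over plans with second marginal \<open>\<xi>\<close> is the weighted transport value,
  in the form with the factor \<open>t i\<close> multiplied out, which covers \<open>t i = 0\<close>.
\<close>

definition pair_objective :: "'i \<Rightarrow> ('a \<times> 'b) measure \<Rightarrow> ereal" where
  "pair_objective i \<pi> = ereal (\<integral>z. t i * c i z \<partial>\<pi>) + ereal \<epsilon> * KL \<pi> (L i \<Otimes>\<^sub>M LY)
     + ereal (t i) * D (\<phi> i) (distr \<pi> (L i) fst) (\<mu> i)"

definition pair_value :: "'i \<Rightarrow> 'b measure \<Rightarrow> ereal" where
  "pair_value i \<xi> = weighted_UOT (L i) LY \<epsilon> (t i) (c i) (\<phi> i) (\<mu> i) \<xi>"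

definition barycenter_functional :: "'b measure \<Rightarrow> ereal" where
  "barycenter_functional \<xi> =
     (if \<exists>i\<in>I. pair_value i \<xi> = \<infinity> then \<infinity>
      else (\<Sum>i\<in>I. pair_value i \<xi>) - ereal (\<epsilon> * (real (card I) - 1)) * KL \<xi> LY)"

lemma integrable_c:
  assumes i: "i \<in> I" and \<pi>: "\<pi> \<in> M_plus (L i \<Otimes>\<^sub>M LY)"
  shows "integrable \<pi> (c i)"
proof -
  interpret p: finite_measure \<pi> using \<pi> by (simp add: M_plus_def)
  have sets: "sets \<pi> = sets (L i \<Otimes>\<^sub>M LY)" using \<pi> by (simp add: M_plus_def)
  then have "space \<pi> = space (L i \<Otimes>\<^sub>M LY)" by (rule sets_eq_imp_space_eq)
  moreover obtain b where "\<forall>z\<in>space (L i \<Otimes>\<^sub>M LY). \<bar>c i z\<bar> \<le> b" using c_bounded[OF i] by blast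
  moreover have "c i \<in> borel_measurable \<pi>" using c_measurable[OF i] measurable_cong_sets[OF sets refl] by blast
  ultimately show ?thesis by (intro p.integrable_const_bound[where B=b]) auto
qed

lemma integral_c_nonneg:
  assumes i: "i \<in> I" and \<pi>: "\<pi> \<in> M_plus (L i \<Otimes>\<^sub>M LY)"
  shows "0 \<le> (\<integral>z. c i z \<partial>\<pi>)"
proof -
  have "space \<pi> = space (L i \<Otimes>\<^sub>M LY)" using \<pi> by (intro sets_eq_imp_space_eq) (simp add: M_plus_def)
  then show ?thesis using c_nonneg[OF i] by (intro Bochner_Integration.integral_nonneg_AE AE_I2) auto
qed

lemma scaled_D_nonneg: "i \<in> I \<Longrightarrow> 0 \<le> ereal (t i) * D (\<phi> i) \<nu> \<nu>'"
  by (intro ereal_0_le_mult D_nonneg \<phi>) (auto simp: t_nonneg)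

lemma pair_objective_nonneg:
  assumes i: "i \<in> I" and \<pi>: "\<pi> \<in> M_plus (L i \<Otimes>\<^sub>M LY)"
  shows "0 \<le> pair_objective i \<pi>"
  unfolding pair_objective_def
  using integral_c_nonneg[OF assms] KL_nonneg[OF finite_Mi \<pi>] t_nonneg[OF i] eps
  by (intro add_nonneg_nonneg scaled_D_nonneg i) (auto intro: ereal_0_le_mult)

text \<open>
  For \<open>t i > 0\<close> all terms are nonnegative, so \<open>t i\<close> may be moved inside the sum and inside the
  infimum, and \<open>D (iota {1})\<close> turns into the constraint on the second marginal.
\<close>

lemma pair_value_eq:
  assumes i: "i \<in> I" and \<xi>: "\<xi> \<in> M_plus LY"
  shows "pair_value i \<xi> = (INF \<pi> \<in> {\<pi> \<in> M_plus (L i \<Otimes>\<^sub>M LY). distr \<pi> LY snd = \<xi>}. pair_objective i \<pi>)"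
proof (cases "t i = 0")
  case True
  then show ?thesis by (simp add: pair_value_def weighted_UOT_def pair_objective_def)
next
  case False
  then have t: "0 < t i" using t_nonneg[OF i] by simp
  let ?P = "M_plus (L i \<Otimes>\<^sub>M LY)"
  let ?u = "\<lambda>\<pi>. ereal (\<integral>z. c i z \<partial>\<pi>) + ereal (\<epsilon> / t i) * KL \<pi> (L i \<Otimes>\<^sub>M LY)
        + D (\<phi> i) (distr \<pi> (L i) fst) (\<mu> i) + D (iota {1}) (distr \<pi> LY snd) \<xi>"
  have u: "ereal (t i) * ?u \<pi> = (if distr \<pi> LY snd = \<xi> then pair_objective i \<pi> else \<infinity>)" if \<pi>: "\<pi> \<in> ?P" for \<pi>
  proof -
    have f: "finite_measure \<pi>" and s[measurable_cong]: "sets \<pi> = sets (L i \<Otimes>\<^sub>M LY)"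
      using \<pi> by (simp_all add: M_plus_def)
    have "D (iota {1}) (distr \<pi> LY snd) \<xi> = (if distr \<pi> LY snd = \<xi> then 0 else \<infinity>)"
      using \<xi> by (intro D_iota finite_measure.finite_measure_distr f) (auto simp: M_plus_def)
    moreover have "0 \<le> KL \<pi> (L i \<Otimes>\<^sub>M LY)" by (rule KL_nonneg[OF finite_Mi \<pi>])
    moreover have "0 \<le> D (\<phi> i) (distr \<pi> (L i) fst) (\<mu> i)" by (rule D_nonneg[OF \<phi>[OF i]])
    ultimately show ?thesis
      using t eps by (cases "KL \<pi> (L i \<Otimes>\<^sub>M LY)"; cases "D (\<phi> i) (distr \<pi> (L i) fst) (\<mu> i)")
        (auto simp: pair_objective_def algebra_simps)
  qed
  have "pair_value i \<xi> = ereal (t i) * Inf (?u ` ?P)"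
    using False by (simp add: pair_value_def weighted_UOT_def UOT_def)
  also have "\<dots> = (INF \<pi>\<in>?P. ereal (t i) * ?u \<pi>)"
    by (rule ereal_cmult_INF[OF t])
  also have "\<dots> = (INF \<pi>\<in>?P. if distr \<pi> LY snd = \<xi> then pair_objective i \<pi> else \<infinity>)"
    by (intro INF_cong u refl)
  also have "\<dots> = (INF \<pi> \<in> {\<pi> \<in> ?P. distr \<pi> LY snd = \<xi>}. pair_objective i \<pi>)"
  proof (rule antisym)
    show "(INF \<pi>\<in>?P. if distr \<pi> LY snd = \<xi> then pair_objective i \<pi> else \<infinity>)
        \<le> (INF \<pi> \<in> {\<pi> \<in> ?P. distr \<pi> LY snd = \<xi>}. pair_objective i \<pi>)"
    proof (rule INF_greatest)
      fix \<pi> assume "\<pi> \<in> {\<pi> \<in> ?P. distr \<pi> LY snd = \<xi>}"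
      then show "(INF \<pi>\<in>?P. if distr \<pi> LY snd = \<xi> then pair_objective i \<pi> else \<infinity>) \<le> pair_objective i \<pi>"
        by (intro INF_lower2[of \<pi>]) auto
    qed
    show "(INF \<pi> \<in> {\<pi> \<in> ?P. distr \<pi> LY snd = \<xi>}. pair_objective i \<pi>)
        \<le> (INF \<pi>\<in>?P. if distr \<pi> LY snd = \<xi> then pair_objective i \<pi> else \<infinity>)"
      by (rule INF_greatest) (auto intro: INF_lower)
  qed
  finally show ?thesis .
qed

lemma pair_value_nonneg:
  assumes "i \<in> I" and "\<xi> \<in> M_plus LY"
  shows "0 \<le> pair_value i \<xi>"
  unfolding pair_value_eq[OF assms] by (rule INF_greatest) (auto intro: pair_objective_nonneg assms)

lemma distr_T_M_plus:
  assumes i: "i \<in> I" and \<pi>: "\<pi> \<in> M_plus M"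
  shows "distr \<pi> (L i \<Otimes>\<^sub>M LY) (T i) \<in> M_plus (L i \<Otimes>\<^sub>M LY)"
proof -
  have f: "finite_measure \<pi>" and [measurable_cong]: "sets \<pi> = sets M" using \<pi> by (simp_all add: M_plus_def)
  have "finite_measure (distr \<pi> (L i \<Otimes>\<^sub>M LY) (T i))"
    using i by (intro finite_measure.finite_measure_distr f) measurable
  then show ?thesis by (simp add: M_plus_def)
qed

lemma distr_snd_M_plus:
  assumes \<pi>: "\<pi> \<in> M_plus M"
  shows "distr \<pi> LY snd \<in> M_plus LY"
proof -
  have f: "finite_measure \<pi>" and [measurable_cong]: "sets \<pi> = sets M" using \<pi> by (simp_all add: M_plus_def)
  have "finite_measure (distr \<pi> LY snd)"
    by (intro finite_measure.finite_measure_distr f) measurable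
  then show ?thesis by (simp add: M_plus_def)
qed

lemma distr_T_snd:
  assumes i: "i \<in> I" and \<pi>: "\<pi> \<in> M_plus M"
  shows "distr (distr \<pi> (L i \<Otimes>\<^sub>M LY) (T i)) LY snd = distr \<pi> LY snd"
proof -
  have [measurable_cong]: "sets \<pi> = sets M" using \<pi> by (simp_all add: M_plus_def)
  show ?thesis using i by (subst distr_distr) (auto simp: comp_def)
qed

text \<open>
  Cost and divergences see the plan only through its pair marginals; the entropy is the only term
  that couples the coordinates.
\<close>

lemma objective_eq:
  assumes \<pi>: "\<pi> \<in> M_plus M"
  defines "\<pi>' \<equiv> \<lambda>i. distr \<pi> (L i \<Otimes>\<^sub>M LY) (T i)"
  shows "objective \<pi> = ereal (\<Sum>i\<in>I. \<integral>z. t i * c i z \<partial>\<pi>' i) + ereal \<epsilon> * KL \<pi> M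
     + (\<Sum>i\<in>I. ereal (t i) * D (\<phi> i) (distr (\<pi>' i) (L i) fst) (\<mu> i))"
proof -
  have f: "finite_measure \<pi>" and [measurable_cong]: "sets \<pi> = sets M" using \<pi> by (simp_all add: M_plus_def)
  have int: "integrable \<pi> (\<lambda>z. c i (T i z))" if i: "i \<in> I" for i
    using integrable_c[OF i distr_T_M_plus[OF i \<pi>]] i c_measurable[OF i]
    by (subst (asm) integrable_distr_eq) auto
  have "(\<integral>z. (\<Sum>i\<in>I. t i * c i (T i z)) \<partial>\<pi>) = (\<Sum>i\<in>I. \<integral>z. t i * c i (T i z) \<partial>\<pi>)"
    using int by (intro Bochner_Integration.integral_sum) auto
  also have "\<dots> = (\<Sum>i\<in>I. \<integral>z. t i * c i z \<partial>\<pi>' i)"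
    unfolding \<pi>'_def using c_measurable by (intro sum.cong refl integral_distr[symmetric]) auto
  finally have 1: "(\<integral>z. (\<Sum>i\<in>I. t i * c i (T i z)) \<partial>\<pi>) = (\<Sum>i\<in>I. \<integral>z. t i * c i z \<partial>\<pi>' i)" .
  have 2: "D (\<lambda>s. ereal (t i) * \<phi> i s) (distr \<pi> (L i) (\<lambda>z. fst z i)) (\<mu> i)
      = ereal (t i) * D (\<phi> i) (distr (\<pi>' i) (L i) fst) (\<mu> i)" if i: "i \<in> I" for i
  proof -
    have "distr (\<pi>' i) (L i) fst = distr \<pi> (L i) (\<lambda>z. fst z i)"
      unfolding \<pi>'_def using i by (subst distr_distr) (auto simp: comp_def)
    moreover have "finite_measure (distr \<pi> (L i) (\<lambda>z. fst z i))"
      using i by (intro finite_measure.finite_measure_distr f) measurable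
    ultimately show ?thesis
      using \<mu>[OF i] by (simp add: D_scale \<phi>[OF i] t_nonneg[OF i] M_plus_def)
  qed
  show ?thesis unfolding objective_def 1 using 2 by simp
qed

text \<open>
  The pair marginals of a plan compete in the transport problems for its marginal on \<open>Y\<close>, and
  the chain rule inequality compares the entropies.
\<close>

lemma objective_ge_barycenter_functional:
  assumes \<pi>: "\<pi> \<in> M_plus M" and fin: "objective \<pi> \<noteq> \<infinity>"
  shows "barycenter_functional (distr \<pi> LY snd) + ereal (\<epsilon> * entropy_offset) \<le> objective \<pi>"
proof -
  let ?\<pi> = "\<lambda>i. distr \<pi> (L i \<Otimes>\<^sub>M LY) (T i)"
  let ?\<xi> = "distr \<pi> LY snd"
  let ?d = "\<lambda>i. ereal (t i) * D (\<phi> i) (distr (?\<pi> i) (L i) fst) (\<mu> i)"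
  note \<xi> = distr_snd_M_plus[OF \<pi>]
  have d_nn: "0 \<le> ?d i" if "i \<in> I" for i
    by (rule scaled_D_nonneg[OF that])
  then have sd_nn: "0 \<le> (\<Sum>i\<in>I. ?d i)" by (rule sum_nonneg)
  have KL0: "0 \<le> KL \<pi> M" by (rule KL_nonneg[OF finite_M \<pi>])
  have KLf: "KL \<pi> M \<noteq> \<infinity>" and sd_fin: "(\<Sum>i\<in>I. ?d i) \<noteq> \<infinity>"
    using fin KL0 sd_nn eps unfolding objective_eq[OF \<pi>] by auto
  obtain \<kappa> where \<kappa>: "KL \<pi> M = ereal \<kappa>" using KL0 KLf by (cases "KL \<pi> M") auto
  define d where "d i = real_of_ereal (?d i)" for i
  have "?d i \<noteq> \<infinity>" if "i \<in> I" for i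
    using sd_fin that finite_I by (auto simp: sum_Pinfty)
  then have d: "?d i = ereal (d i)" if "i \<in> I" for i
    using d_nn[OF that] that by (cases "?d i") (auto simp: d_def)
  obtain k kY where k: "\<And>i. i \<in> I \<Longrightarrow> KL (?\<pi> i) (L i \<Otimes>\<^sub>M LY) = ereal (k i)"
    and kY: "KL ?\<xi> LY = ereal kY"
    and le: "ereal ((\<Sum>i\<in>I. k i) - (real (card I) - 1) * kY + entropy_offset) \<le> KL \<pi> M"
    by (rule KL_ge_sum_pair_marginals[OF \<pi> KLf]) blast
  define a where "a i = (\<integral>z. t i * c i z \<partial>?\<pi> i)" for i
  have pair: "pair_objective i (?\<pi> i) = ereal (a i + \<epsilon> * k i + d i)" if "i \<in> I" for i
    unfolding pair_objective_def using k[OF that] d[OF that] by (simp add: a_def)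
  have v_le: "pair_value i ?\<xi> \<le> ereal (a i + \<epsilon> * k i + d i)" if i: "i \<in> I" for i
    unfolding pair_value_eq[OF i \<xi>] pair[OF i, symmetric]
    by (rule INF_lower) (auto simp: distr_T_M_plus[OF i \<pi>] distr_T_snd[OF i \<pi>])
  define v where "v i = real_of_ereal (pair_value i ?\<xi>)" for i
  have v: "pair_value i ?\<xi> = ereal (v i)" if i: "i \<in> I" for i
    using v_le[OF i] pair_value_nonneg[OF i \<xi>] unfolding v_def by (cases "pair_value i ?\<xi>") auto
  have "(\<Sum>i\<in>I. v i) \<le> (\<Sum>i\<in>I. a i + \<epsilon> * k i + d i)"
    using v_le v by (intro sum_mono) auto
  also have "\<dots> = (\<Sum>i\<in>I. a i) + \<epsilon> * (\<Sum>i\<in>I. k i) + (\<Sum>i\<in>I. d i)"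
    by (simp add: sum.distrib sum_distrib_left)
  finally have v_sum: "(\<Sum>i\<in>I. v i) \<le> (\<Sum>i\<in>I. a i) + \<epsilon> * (\<Sum>i\<in>I. k i) + (\<Sum>i\<in>I. d i)" .
  have "\<epsilon> * ((\<Sum>i\<in>I. k i) - (real (card I) - 1) * kY + entropy_offset) \<le> \<epsilon> * \<kappa>"
    using le \<kappa> eps by (intro mult_left_mono) auto
  with v_sum have "(\<Sum>i\<in>I. v i) - \<epsilon> * (real (card I) - 1) * kY + \<epsilon> * entropy_offset
      \<le> (\<Sum>i\<in>I. a i) + \<epsilon> * \<kappa> + (\<Sum>i\<in>I. d i)"
    by (simp add: algebra_simps)
  moreover have "barycenter_functional ?\<xi> = ereal ((\<Sum>i\<in>I. v i) - \<epsilon> * (real (card I) - 1) * kY)"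
    unfolding barycenter_functional_def using v kY by simp
  moreover have "objective \<pi> = ereal ((\<Sum>i\<in>I. a i) + \<epsilon> * \<kappa> + (\<Sum>i\<in>I. d i))"
  proof -
    have "(\<Sum>i\<in>I. ?d i) = ereal (\<Sum>i\<in>I. d i)"
      unfolding sum_ereal[symmetric] by (intro sum.cong refl) (simp add: d)
    then show ?thesis unfolding objective_eq[OF \<pi>] \<kappa> by (simp add: a_def)
  qed
  ultimately show ?thesis by simp
qed

text \<open>
  Gluing loses nothing: the glued plan has the given pair marginals, and the chain rule is an
  equality for it.
\<close>

lemma exists_glued_plan:
  assumes \<pi>: "\<And>i. i \<in> I \<Longrightarrow> \<pi> i \<in> M_plus (L i \<Otimes>\<^sub>M LY)"
    and \<xi>: "\<And>i. i \<in> I \<Longrightarrow> distr (\<pi> i) LY snd = \<xi>"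
    and v: "\<And>i. i \<in> I \<Longrightarrow> pair_objective i (\<pi> i) = ereal (v i)"
  obtains \<rho> kY where "\<rho> \<in> M_plus M" "KL \<xi> LY = ereal kY"
    "objective \<rho> = ereal ((\<Sum>i\<in>I. v i) - \<epsilon> * (real (card I) - 1) * kY + \<epsilon> * entropy_offset)"
proof -
  let ?d = "\<lambda>i. ereal (t i) * D (\<phi> i) (distr (\<pi> i) (L i) fst) (\<mu> i)"
  have d_nn: "0 \<le> ?d i" if "i \<in> I" for i
    by (rule scaled_D_nonneg[OF that])
  have KL0: "0 \<le> KL (\<pi> i) (L i \<Otimes>\<^sub>M LY)" if "i \<in> I" for i by (rule KL_nonneg[OF finite_Mi \<pi>[OF that]])
  define d where "d i = real_of_ereal (?d i)" for i
  define k where "k i = real_of_ereal (KL (\<pi> i) (L i \<Otimes>\<^sub>M LY))" for i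
  define a where "a i = (\<integral>z. t i * c i z \<partial>\<pi> i)" for i
  have kd: "KL (\<pi> i) (L i \<Otimes>\<^sub>M LY) = ereal (k i) \<and> ?d i = ereal (d i) \<and> v i = a i + \<epsilon> * k i + d i"
    if i: "i \<in> I" for i
    using v[OF i] d_nn[OF i] KL0[OF i] eps unfolding pair_objective_def a_def k_def d_def
    by (cases "KL (\<pi> i) (L i \<Otimes>\<^sub>M LY)"; cases "?d i") auto
  obtain \<rho> kY where \<rho>: "\<rho> \<in> M_plus M"
    and marg: "\<And>i. i \<in> I \<Longrightarrow> distr \<rho> (L i \<Otimes>\<^sub>M LY) (T i) = \<pi> i"
    and kY: "KL \<xi> LY = ereal kY"
    and KL: "KL \<rho> M = ereal ((\<Sum>i\<in>I. k i) - (real (card I) - 1) * kY + entropy_offset)"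
    by (rule KL_of_glued_plan[of \<pi> k \<xi>]) (use \<pi> kd \<xi> in auto)
  have 1: "(\<Sum>i\<in>I. \<integral>z. t i * c i z \<partial>distr \<rho> (L i \<Otimes>\<^sub>M LY) (T i)) = (\<Sum>i\<in>I. a i)"
    by (intro sum.cong refl) (simp add: marg a_def)
  have 2: "(\<Sum>i\<in>I. ereal (t i) * D (\<phi> i) (distr (distr \<rho> (L i \<Otimes>\<^sub>M LY) (T i)) (L i) fst) (\<mu> i)) = ereal (\<Sum>i\<in>I. d i)"
    unfolding sum_ereal[symmetric] using kd by (intro sum.cong refl) (simp add: marg)
  have v_sum: "(\<Sum>i\<in>I. v i) = (\<Sum>i\<in>I. a i) + \<epsilon> * (\<Sum>i\<in>I. k i) + (\<Sum>i\<in>I. d i)"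
    using kd by (simp add: sum.distrib sum_distrib_left)
  have "objective \<rho> = ereal ((\<Sum>i\<in>I. v i) - \<epsilon> * (real (card I) - 1) * kY + \<epsilon> * entropy_offset)"
    unfolding objective_eq[OF \<rho>] 1 2 KL v_sum by (simp add: algebra_simps)
  with \<rho> kY show ?thesis by (rule that)
qed

text \<open>
  The infima in the transport problems need not be attained, so plans that are optimal up to
  \<open>e / card I\<close> are glued and \<open>e\<close> tends to zero.
\<close>

lemma objective_minimum_le_barycenter_functional:
  assumes min: "\<And>\<rho>. \<rho> \<in> M_plus M \<Longrightarrow> m \<le> objective \<rho>"
    and \<xi>: "\<xi> \<in> M_plus LY" and fin: "barycenter_functional \<xi> \<noteq> \<infinity>"
  shows "m \<le> barycenter_functional \<xi> + ereal (\<epsilon> * entropy_offset)"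
proof (rule ereal_le_epsilon2)
  fix e :: real assume e: "0 < e"
  let ?n = "real (card I)"
  have n: "0 < ?n" using finite_I nonempty_I by (simp add: card_gt_0_iff)
  define u where "u i = real_of_ereal (pair_value i \<xi>)" for i
  have u: "pair_value i \<xi> = ereal (u i)" if i: "i \<in> I" for i
    using fin i pair_value_nonneg[OF i \<xi>] unfolding u_def barycenter_functional_def
    by (cases "pair_value i \<xi>") (auto split: if_splits)
  have "\<exists>\<pi>. \<pi> \<in> M_plus (L i \<Otimes>\<^sub>M LY) \<and> distr \<pi> LY snd = \<xi> \<and> pair_objective i \<pi> < ereal (u i + e / ?n)"
    if i: "i \<in> I" for i
  proof -
    have "pair_value i \<xi> < ereal (u i + e / ?n)" using u[OF i] e n by simp
    then show ?thesis unfolding pair_value_eq[OF i \<xi>] INF_less_iff by auto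
  qed
  then have "\<forall>i\<in>I. \<exists>\<pi>. \<pi> \<in> M_plus (L i \<Otimes>\<^sub>M LY) \<and> distr \<pi> LY snd = \<xi> \<and> pair_objective i \<pi> < ereal (u i + e / ?n)"
    by blast
  from bchoice[OF this] obtain \<pi> where \<pi>: "\<forall>i\<in>I. \<pi> i \<in> M_plus (L i \<Otimes>\<^sub>M LY) \<and> distr (\<pi> i) LY snd = \<xi>
      \<and> pair_objective i (\<pi> i) < ereal (u i + e / ?n)" ..
  define v where "v i = real_of_ereal (pair_objective i (\<pi> i))" for i
  have v: "pair_objective i (\<pi> i) = ereal (v i)" if i: "i \<in> I" for i
  proof -
    have "0 \<le> pair_objective i (\<pi> i)" "pair_objective i (\<pi> i) < ereal (u i + e / ?n)"
      using \<pi> i pair_objective_nonneg by auto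
    then show ?thesis unfolding v_def by (cases "pair_objective i (\<pi> i)") auto
  qed
  obtain \<rho> kY where \<rho>: "\<rho> \<in> M_plus M" and kY: "KL \<xi> LY = ereal kY"
    and obj: "objective \<rho> = ereal ((\<Sum>i\<in>I. v i) - \<epsilon> * (?n - 1) * kY + \<epsilon> * entropy_offset)"
    by (rule exists_glued_plan[of \<pi> \<xi> v]) (use \<pi> v in auto)
  have "(\<Sum>i\<in>I. v i) \<le> (\<Sum>i\<in>I. u i + e / ?n)"
    using \<pi> v by (intro sum_mono) (metis ereal_less_eq(3) less_imp_le)
  also have "\<dots> = (\<Sum>i\<in>I. u i) + e" using n by (simp add: sum.distrib)
  finally have le: "(\<Sum>i\<in>I. v i) \<le> (\<Sum>i\<in>I. u i) + e" .
  have bf: "barycenter_functional \<xi> = ereal ((\<Sum>i\<in>I. u i) - \<epsilon> * (?n - 1) * kY)"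
    unfolding barycenter_functional_def using u kY by simp
  have "m \<le> objective \<rho>" by (rule min[OF \<rho>])
  also have "\<dots> \<le> barycenter_functional \<xi> + ereal (\<epsilon> * entropy_offset) + ereal e"
    unfolding obj bf using le by simp
  finally show "m \<le> barycenter_functional \<xi> + ereal (\<epsilon> * entropy_offset) + ereal e" .
qed

theorem marginal_of_minimizer:
  assumes "minimizes_over objective (M_plus M) \<pi>"
  shows "minimizes_over barycenter_functional (M_plus LY) (distr \<pi> LY snd)"
  unfolding minimizes_over_def
proof (intro conjI ballI)
  have \<pi>: "\<pi> \<in> M_plus M" and min: "\<And>\<rho>. \<rho> \<in> M_plus M \<Longrightarrow> objective \<pi> \<le> objective \<rho>"
    using assms by (auto simp: minimizes_over_def)
  show "distr \<pi> LY snd \<in> M_plus LY" by (rule distr_snd_M_plus[OF \<pi>])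
  fix \<xi> assume \<xi>: "\<xi> \<in> M_plus LY"
  show "barycenter_functional (distr \<pi> LY snd) \<le> barycenter_functional \<xi>"
  proof (cases "barycenter_functional \<xi> = \<infinity>")
    case False
    have upper: "objective \<pi> \<le> barycenter_functional \<xi> + ereal (\<epsilon> * entropy_offset)"
      by (rule objective_minimum_le_barycenter_functional[OF min \<xi> False])
    then have "objective \<pi> \<noteq> \<infinity>" using False by auto
    then have "barycenter_functional (distr \<pi> LY snd) + ereal (\<epsilon> * entropy_offset) \<le> objective \<pi>"
      by (rule objective_ge_barycenter_functional[OF \<pi>])
    from order_trans[OF this upper] show ?thesis
      by (cases "barycenter_functional \<xi>"; cases "barycenter_functional (distr \<pi> LY snd)") auto
  qed simp
qed

end

theorem theorem5p2:
  fixes \<epsilon> :: real and N :: nat and t :: "nat \<Rightarrow> real"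
    and X :: "nat \<Rightarrow> 'p base_space" and Y :: "'q base_space"
    and \<mu> :: "nat \<Rightarrow> 'p pt measure"
    and \<phi> :: "nat \<Rightarrow> real \<Rightarrow> ereal"
    and c :: "nat \<Rightarrow> 'p pt \<times> 'q pt \<Rightarrow> real"
    and \<pi>_hat :: "((nat \<Rightarrow> 'p pt) \<times> 'q pt) measure"
  assumes "\<epsilon> > 0" and "N \<ge> 1"
    and "\<forall>i\<in>{1..N}. t i \<ge> 0" and "(\<Sum>i=1..N. t i) = 1"
    and "\<forall>i\<in>{1..N}. admissible (X i)" and "admissible Y"
    and "\<forall>i\<in>{1..N}. \<mu> i \<in> M_plus (ref (X i))"
    and "\<forall>i\<in>{1..N}. supp (top_of (X i)) (\<mu> i) = topspace (top_of (X i))"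
    and "KL (\<Pi>\<^sub>M i\<in>{1..N}. \<mu> i) (ref_X N X) < \<infinity>"
    and "\<forall>i\<in>{1..N}. entropy_function (\<phi> i)"
    and "\<forall>i\<in>{1..N}. continuous_map (prod_topology (top_of (X i)) (top_of Y)) euclideanreal (c i)"
    and "\<forall>i\<in>{1..N}. \<forall>z\<in>topspace (top_of (X i)) \<times> topspace (top_of Y). c i z \<ge> 0"
    and "minimizes_over (multi_marginal_objective N \<epsilon> t X Y c \<phi> \<mu>)
           (M_plus (ref_X N X \<Otimes>\<^sub>M ref Y)) \<pi>_hat"
  shows "minimizes_over (barycenter_objective N \<epsilon> t X Y c \<phi> \<mu>)
           (M_plus (ref Y)) (distr \<pi>_hat (ref Y) snd)"
proof -
  \<comment> \<open>The locale asks for a finite measure at every index, so indices outside \<open>{1..N}\<close> get a dummy.\<close>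
  define L where "L i = (if i \<in> {1..N} then ref (X i) else null_measure (count_space UNIV))" for i
  have L: "L i = ref (X i)" if "i \<in> {1..N}" for i using that by (simp add: L_def)
  have space: "space (L i \<Otimes>\<^sub>M ref Y) = topspace (top_of (X i)) \<times> topspace (top_of Y)" if "i \<in> {1..N}" for i
    using that assms(5,6) by (simp add: L space_pair_measure space_ref)
  interpret barycenter_problem "{1..N}" L "ref Y" \<epsilon> t c \<phi> \<mu>
  proof (intro barycenter_problem.intro finite_product_spaces.intro barycenter_problem_axioms.intro)
    show "finite_measure (L i)" for i
    proof (cases "i \<in> {1..N}")
      case True
      then show ?thesis using assms(5) by (simp only: L) (intro finite_measure_ref, blast)
    next
      case False
      then show ?thesis by (simp only: L_def if_False) (rule finite_measureI, simp)
    qed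
    show "finite_measure (ref Y)" by (rule finite_measure_ref[OF assms(6)])
    fix i assume i: "i \<in> {1..N}"
    note adm = bspec[OF assms(5) i] assms(6) and cont = bspec[OF assms(11) i]
    show "c i \<in> borel_measurable (L i \<Otimes>\<^sub>M ref Y)"
      unfolding L[OF i] by (rule continuous_map_borel_measurable[OF adm cont])
    show "\<exists>b. \<forall>z\<in>space (L i \<Otimes>\<^sub>M ref Y). \<bar>c i z\<bar> \<le> b"
      unfolding L[OF i] by (rule continuous_map_bounded[OF adm cont]) blast
    show "\<mu> i \<in> M_plus (L i)" unfolding L[OF i] using assms(7) i by blast
    show "0 \<le> c i z" if "z \<in> space (L i \<Otimes>\<^sub>M ref Y)" for z
      using that assms(12) i unfolding space[OF i] by blast
  qed (use assms in auto)
  have refX: "ref_X N X = PiM {1..N} L" unfolding ref_X_def by (intro PiM_cong) (auto simp: L)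
  have "multi_marginal_objective N \<epsilon> t X Y c \<phi> \<mu> = objective"
  proof
    fix \<pi> :: "((nat \<Rightarrow> 'p pt) \<times> 'q pt) measure"
    have "(\<Sum>i=1..N. D (\<lambda>s. ereal (t i) * \<phi> i s) (distr \<pi> (ref (X i)) (\<lambda>(x, y). x i)) (\<mu> i))
        = (\<Sum>i=1..N. D (\<lambda>s. ereal (t i) * \<phi> i s) (distr \<pi> (L i) (\<lambda>z. fst z i)) (\<mu> i))"
      by (intro sum.cong refl) (simp add: L case_prod_beta')
    then show "multi_marginal_objective N \<epsilon> t X Y c \<phi> \<mu> \<pi> = objective \<pi>"
      by (simp add: multi_marginal_objective_def objective_def refX c_t_def case_prod_beta' del: One_nat_def)
  qed
  moreover have "barycenter_objective N \<epsilon> t X Y c \<phi> \<mu> = barycenter_functional"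
  proof
    fix \<xi> :: "'q pt measure"
    have U: "weighted_UOT (ref (X i)) (ref Y) \<epsilon> (t i) (c i) (\<phi> i) (\<mu> i) \<xi> = pair_value i \<xi>" if "i \<in> {1..N}" for i
      by (simp only: pair_value_def L[OF that])
    then have "(\<Sum>i=1..N. weighted_UOT (ref (X i)) (ref Y) \<epsilon> (t i) (c i) (\<phi> i) (\<mu> i) \<xi>) = (\<Sum>i=1..N. pair_value i \<xi>)"
      by (intro sum.cong refl)
    with U show "barycenter_objective N \<epsilon> t X Y c \<phi> \<mu> \<xi> = barycenter_functional \<xi>"
      by (simp add: barycenter_objective_def barycenter_functional_def del: One_nat_def)
  qed
  ultimately show ?thesis
    using marginal_of_minimizer assms(13) by (simp add: refX del: One_nat_def)
qed

end
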